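(* Let $\tau\in[0,1]$ and $\theta\in[0,1]$ and let $$\mathbf{q}=\left(\frac{4}{2+\tau-\theta\tau},\ \frac{4}{\theta+3},\ \frac{4}{3+\theta\tau-\theta-\tau}\right).$$ Then the optimal constant of the generalized Bohnenblust--Hille inequality for real scalars with exponent $\mathbf{q}$ (for $3$-linear forms) is $$C_{3,\mathbf{q}}^{\mathbb{R}}=2^{\frac{\theta+3}{4}}.$$
   Context: Let $c_0$ be the real Banach space of real null sequences with the supremum norm, with canonical unit vectors $(e_j)_{j\ge1}$, and for a continuous $3$-linear form $T:c_0\times c_0\times c_0\to\mathbb{R}$ put $\|T\|=\sup\{|T(z_1,z_2,z_3)|:\|z_k\|\le 1,\ k=1,2,3\}$. For $\mathbf{q}=(q_1,q_2,q_3)\in[1,2]^3$, $C_{3,\mathbf{q}}^{\mathbb{R}}$ denotes the optimal (smallest) constant $C$ such that $$\left(\sum_{j_1=1}^{N}\left(\sum_{j_2=1}^{N}\left(\sum_{j_3=1}^{N}\left|T(e_{j_1},e_{j_2},e_{j_3})\right|^{q_3}\right)^{\frac{q_2}{q_3}}\right)^{\frac{q_1}{q_2}}\right)^{\frac{1}{q_1}}\leq C\,\|T\|$$ for all continuous $3$-linear forms $T:c_0\times c_0\times c_0\to\mathbb{R}$ and all positive integers $N$. *)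

theory Defs
  imports "HOL-Analysis.Analysis"
begin

section \<open>The real Banach space of null sequences\<close>

typedef c0 = "{x :: nat \<Rightarrow> real. x \<longlonglongrightarrow> 0}"
  morphisms coord Abs_c0
  by (rule exI[of _ "\<lambda>_. 0"]) simp

setup_lifting type_definition_c0

lemma coord_tendsto_0: "coord x \<longlonglongrightarrow> 0"
  using coord[of x] by simp

lemma c0_eqI: "(\<And>n. coord x n = coord y n) \<Longrightarrow> x = y"
  by (simp add: coord_inject[symmetric] fun_eq_iff)

instantiation c0 :: real_vector
begin

lift_definition zero_c0 :: c0 is "\<lambda>_. 0"
  by simp

lift_definition plus_c0 :: "c0 \<Rightarrow> c0 \<Rightarrow> c0" is "\<lambda>x y n. x n + y n"
  using tendsto_add_zero by blast

lift_definition minus_c0 :: "c0 \<Rightarrow> c0 \<Rightarrow> c0" is "\<lambda>x y n. x n - y n"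
  using tendsto_diff[of _ "0::real" sequentially _ 0] by simp

lift_definition uminus_c0 :: "c0 \<Rightarrow> c0" is "\<lambda>x n. - x n"
  using tendsto_minus[of _ "0::real" sequentially] by simp

lift_definition scaleR_c0 :: "real \<Rightarrow> c0 \<Rightarrow> c0" is "\<lambda>a x n. a * x n"
  using tendsto_mult_right_zero by blast

instance
  by standard (transfer; simp add: algebra_simps)+

end

lemmas coord_simps [simp] =
  zero_c0.rep_eq plus_c0.rep_eq minus_c0.rep_eq uminus_c0.rep_eq scaleR_c0.rep_eq

instantiation c0 :: real_normed_vector
begin

definition norm_c0 :: "c0 \<Rightarrow> real"
  where "norm_c0 x = (SUP n. \<bar>coord x n\<bar>)"

definition dist_c0 :: "c0 \<Rightarrow> c0 \<Rightarrow> real"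
  where "dist_c0 x y = norm (x - y)"

definition sgn_c0 :: "c0 \<Rightarrow> c0"
  where "sgn_c0 x = x /\<^sub>R norm x"

definition uniformity_c0 :: "(c0 \<times> c0) filter"
  where "uniformity_c0 = (INF e\<in>{0 <..}. principal {(x, y). dist x y < e})"

definition open_c0 :: "c0 set \<Rightarrow> bool"
  where "open_c0 S = (\<forall>x\<in>S. \<forall>\<^sub>F (x', y) in uniformity. x' = x \<longrightarrow> y \<in> S)"

lemma bdd_above_coord: "bdd_above (range (\<lambda>n. \<bar>coord x n\<bar>))"
proof -
  have "Bseq (coord x)"
    using coord_tendsto_0 convergent_imp_Bseq convergentI by blast
  then obtain K where "\<And>n. norm (coord x n) \<le> K"
    by (auto simp: Bseq_def)
  then show ?thesis
    by (intro bdd_aboveI2[where M = K]) simp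
qed

lemma abs_coord_le_norm: "\<bar>coord x n\<bar> \<le> norm x"
  unfolding norm_c0_def by (rule cSUP_upper[OF UNIV_I bdd_above_coord])

lemma norm_c0_le: "(\<And>n. \<bar>coord x n\<bar> \<le> b) \<Longrightarrow> norm x \<le> b"
  unfolding norm_c0_def by (rule cSUP_least) auto

instance
proof
  fix x y :: c0 and a :: real
  show "norm x = 0 \<longleftrightarrow> x = 0"
  proof
    assume "norm x = 0"
    then have "\<bar>coord x n\<bar> \<le> 0" for n
      using abs_coord_le_norm[of x n] by simp
    then show "x = 0"
      by (intro c0_eqI) simp
  qed (simp add: norm_c0_def)
  show "norm (x + y) \<le> norm x + norm y"
  proof (rule norm_c0_le)
    fix n
    show "\<bar>coord (x + y) n\<bar> \<le> norm x + norm y"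
      using abs_coord_le_norm[of x n] abs_coord_le_norm[of y n] by simp
  qed
  show "norm (a *\<^sub>R x) = \<bar>a\<bar> * norm x"
  proof (rule antisym)
    show "norm (a *\<^sub>R x) \<le> \<bar>a\<bar> * norm x"
      by (rule norm_c0_le) (simp add: abs_mult mult_left_mono abs_coord_le_norm)
    show "\<bar>a\<bar> * norm x \<le> norm (a *\<^sub>R x)"
    proof (cases "a = 0")
      case True
      then show ?thesis
        using abs_coord_le_norm[of "a *\<^sub>R x" 0] by simp
    next
      case False
      have "norm x \<le> norm (a *\<^sub>R x) / \<bar>a\<bar>"
      proof (rule norm_c0_le)
        fix n
        show "\<bar>coord x n\<bar> \<le> norm (a *\<^sub>R x) / \<bar>a\<bar>"
          using abs_coord_le_norm[of "a *\<^sub>R x" n] False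
          by (simp add: abs_mult field_simps)
      qed
      with False show ?thesis
        by (simp add: field_simps)
    qed
  qed
qed (rule dist_c0_def sgn_c0_def uniformity_c0_def open_c0_def)+

end

instance c0 :: banach
proof
  fix X :: "nat \<Rightarrow> c0"
  assume X: "Cauchy X"
  have coord_diff: "\<bar>coord (X m) k - coord (X n) k\<bar> \<le> dist (X m) (X n)" for m n k
    using abs_coord_le_norm[of "X m - X n" k] by (simp add: dist_norm)
  have "Cauchy (\<lambda>n. coord (X n) k)" for k
    using X coord_diff unfolding Cauchy_def dist_real_def
    by (meson le_less_trans)
  then have "\<exists>l. (\<lambda>n. coord (X n) k) \<longlonglongrightarrow> l" for k
    using real_Cauchy_convergent by (auto simp: convergent_def)
  then obtain l where l: "\<And>k. (\<lambda>n. coord (X n) k) \<longlonglongrightarrow> l k"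
    by metis
  have unif: "\<exists>M. \<forall>m\<ge>M. \<forall>k. \<bar>coord (X m) k - l k\<bar> \<le> e" if "e > 0" for e
  proof -
    obtain M where M: "\<And>m n. m \<ge> M \<Longrightarrow> n \<ge> M \<Longrightarrow> dist (X m) (X n) < e"
      using X \<open>e > 0\<close> unfolding Cauchy_def by blast
    have "\<bar>coord (X m) k - l k\<bar> \<le> e" if "m \<ge> M" for m k
    proof (rule LIMSEQ_le_const2)
      show "(\<lambda>n. \<bar>coord (X m) k - coord (X n) k\<bar>) \<longlonglongrightarrow> \<bar>coord (X m) k - l k\<bar>"
        by (intro tendsto_intros l)
      show "\<exists>N. \<forall>n\<ge>N. \<bar>coord (X m) k - coord (X n) k\<bar> \<le> e"
        using M[OF that] coord_diff by (meson le_less_trans less_imp_le)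
    qed
    then show ?thesis
      by blast
  qed
  have "l \<longlonglongrightarrow> 0"
  proof (rule LIMSEQ_I)
    fix r :: real
    assume "r > 0"
    then obtain M where M: "\<And>k. \<bar>coord (X M) k - l k\<bar> \<le> r / 2"
      using unif[of "r / 2"] by auto
    obtain K where "\<And>k. k \<ge> K \<Longrightarrow> \<bar>coord (X M) k\<bar> < r / 2"
      using LIMSEQ_D[OF coord_tendsto_0, of "r / 2" "X M"] \<open>r > 0\<close> by auto
    then have "\<bar>l k\<bar> < r" if "k \<ge> K" for k
      using M[of k] that by (smt (verit) field_sum_of_halves)
    then show "\<exists>K. \<forall>k\<ge>K. norm (l k - 0) < r"
      by auto
  qed
  then have coord_l: "coord (Abs_c0 l) = l"
    by (simp add: Abs_c0_inverse)
  have "X \<longlonglongrightarrow> Abs_c0 l"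
  proof (rule metric_LIMSEQ_I)
    fix r :: real
    assume "r > 0"
    then obtain M where M: "\<And>m k. m \<ge> M \<Longrightarrow> \<bar>coord (X m) k - l k\<bar> \<le> r / 2"
      using unif[of "r / 2"] by auto
    have "dist (X m) (Abs_c0 l) \<le> r / 2" if "m \<ge> M" for m
      unfolding dist_norm
    proof (rule norm_c0_le)
      fix k
      show "\<bar>coord (X m - Abs_c0 l) k\<bar> \<le> r / 2"
        using M[OF that, of k] by (simp only: coord_l minus_c0.rep_eq)
    qed
    moreover have "r / 2 < r"
      using \<open>r > 0\<close> by simp
    ultimately show "\<exists>M. \<forall>m\<ge>M. dist (X m) (Abs_c0 l) < r"
      by (meson le_less_trans)
  qed
  then show "convergent X"
    by (rule convergentI)
qed

text \<open>Coordinates are numbered from \<open>0\<close>, so \<open>unit_vec j\<close> is the canonical unit vector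
  \<open>e\<close> with index \<open>j + 1\<close>, and sums over the indices \<open>1, \<dots>, N\<close> become sums over \<open>j < N\<close>.\<close>

lift_definition unit_vec :: "nat \<Rightarrow> c0" is "\<lambda>j n. if n = j then 1 else 0"
proof -
  fix j :: nat
  have "\<forall>\<^sub>F n in sequentially. (if n = j then 1 else 0 :: real) = 0"
    using eventually_gt_at_top[of j] by eventually_elim simp
  then show "(\<lambda>n. if n = j then 1 else 0 :: real) \<longlonglongrightarrow> 0"
    by (rule tendsto_eventually)
qed


section \<open>Trilinear forms and the Bohnenblust--Hille inequality\<close>

definition trilinear :: "(c0 \<Rightarrow> c0 \<Rightarrow> c0 \<Rightarrow> real) \<Rightarrow> bool" where
  "trilinear T \<longleftrightarrow>
     (\<forall>y z. linear (\<lambda>x. T x y z)) \<and>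
     (\<forall>x z. linear (\<lambda>y. T x y z)) \<and>
     (\<forall>x y. linear (\<lambda>z. T x y z))"

definition continuous_trilinear :: "(c0 \<Rightarrow> c0 \<Rightarrow> c0 \<Rightarrow> real) \<Rightarrow> bool" where
  "continuous_trilinear T \<longleftrightarrow>
     trilinear T \<and> continuous_on UNIV (\<lambda>(x, y, z). T x y z)"

definition form_norm :: "(c0 \<Rightarrow> c0 \<Rightarrow> c0 \<Rightarrow> real) \<Rightarrow> real" where
  "form_norm T = Sup {\<bar>T x y z\<bar> | x y z. norm x \<le> 1 \<and> norm y \<le> 1 \<and> norm z \<le> 1}"

definition mixed_sum ::
  "real \<times> real \<times> real \<Rightarrow> nat \<Rightarrow> (c0 \<Rightarrow> c0 \<Rightarrow> c0 \<Rightarrow> real) \<Rightarrow> real" where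
  "mixed_sum = (\<lambda>(q1, q2, q3) N T.
     (\<Sum>j1<N.
       (\<Sum>j2<N.
         (\<Sum>j3<N. \<bar>T (unit_vec j1) (unit_vec j2) (unit_vec j3)\<bar> powr q3)
         powr (q2 / q3))
       powr (q1 / q2))
     powr (1 / q1))"

definition BH_bound :: "real \<times> real \<times> real \<Rightarrow> real \<Rightarrow> bool" where
  "BH_bound q C \<longleftrightarrow>
     (\<forall>T N. continuous_trilinear T \<longrightarrow> N \<ge> 1 \<longrightarrow> mixed_sum q N T \<le> C * form_norm T)"

text \<open>A predicate rather than a function, because for a general exponent no admissible constant
  need exist: \<open>C\<close> is admissible and no admissible constant is smaller.\<close>

definition optimal_BH_constant :: "real \<times> real \<times> real \<Rightarrow> real \<Rightarrow> bool" where
  "optimal_BH_constant q C \<longleftrightarrow> BH_bound q C \<and> (\<forall>C'. BH_bound q C' \<longrightarrow> C \<le> C')"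

end

theory Submission
  imports Defs
begin

text \<open>
  The reciprocal exponents are a convex combination of three endpoints:
  \<open>1/q = \<theta> (1/2, 1, 1/2) + (1 - \<theta>) (\<tau> (3/4, 3/4, 1/2) + (1 - \<tau>) (1/2, 3/4, 3/4))\<close>.
  By Hoelder's inequality the logarithm of a mixed norm is convex in the reciprocal exponents
  (\<open>mixed_norm_interpolation\<close>), so the upper bound follows once the endpoint \<open>(2, 1, 2)\<close> is known
  with constant \<open>2\<close> and the endpoints \<open>(4/3, 4/3, 2)\<close> and \<open>(2, 4/3, 4/3)\<close> with constant
  \<open>2 powr (3/4)\<close>. At \<open>(4/3, 4/3, 2)\<close> random signs in the third variable turn the form into
  bilinear forms, for which Littlewood's 4/3 inequality costs \<open>sqrt 2\<close>, and replacing the inner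
  square function by the average over the signs costs the Khinchine constant \<open>2 powr (1/4)\<close>.
  Minkowski's inequality moves this to \<open>(2, 4/3, 4/3)\<close>, and \<open>(2, 1, 2)\<close> is Minkowski's inequality
  together with two applications of the \<open>L1\<close> Khinchine inequality, each of which costs \<open>sqrt 2\<close>.

  Everything thus rests on the sharp Khinchine inequality for the exponent 4/3
  (\<open>khinchine_four_thirds\<close>): if \<open>S = \<Sum> a k * e k\<close> with independent signs \<open>e k\<close> and
  \<open>\<Sum> (a k)\<^sup>2 = 1\<close>, then the average of \<open>\<bar>S\<bar> powr (4/3)\<close> is at least \<open>2 powr (-1/3)\<close>, with equality
  for two equal coefficients. The sharp \<open>L1\<close> inequality is a consequence, because \<open>L(4/3)\<close> lies
  half way between \<open>L1\<close> and \<open>L2\<close>. The proof for 4/3 is elementary and uses a discrete form of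
  Stein's method. Flipping the sign \<open>e i\<close> and writing \<open>x\<close> and \<open>y\<close> for \<open>\<bar>a i\<bar> + T\<close> and \<open>\<bar>a i\<bar> - T\<close>,
  where \<open>T\<close> is the rest of the sum, turns the average of \<open>S * G S\<close> for odd \<open>G\<close> into a sum over \<open>i\<close>
  of averages of \<open>(a i)\<^sup>2 * (G x + G y) / (x + y)\<close>. Lower bounds for averages of functions of \<open>S\<close>
  therefore follow from inequalities in two real variables (\<open>stein_bound\<close>). Three
  cases cover all coefficient vectors. If some \<open>\<bar>a i\<bar>\<close> is at least \<open>37/50\<close>, then \<open>\<bar>S\<bar>\<close> has average
  at least \<open>37/50\<close>, the choice \<open>G s = - s * \<bar>s\<bar>\<close> bounds the third absolute moment by twice the
  first, and a cubic minorant of \<open>s powr (4/3)\<close> finishes. If \<open>\<bar>a i * a j\<bar>\<close> is at least \<open>1/3\<close> for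
  some \<open>i \<noteq> j\<close>, which is the neighbourhood of the extremal vector, then conditioning on
  \<open>e i * e j\<close> reduces the claim to sums with fewer coefficients. In the remaining case
  \<open>\<Sum> (a k) ^ 4\<close> is small, and Stein's inequality with \<open>G s = \<alpha> s - \<beta> (root 3 s) ^ 5\<close> gives a
  lower bound of the form \<open>\<kappa> - \<lambda> \<Sum> (a k) ^ 4\<close> that suffices.

  Optimality is witnessed by \<open>(x0 + x1) B(y, z) + (x0 - x1) B'(y, z)\<close>, where \<open>B\<close> and \<open>B'\<close> are
  copies of Littlewood's form \<open>y0 z0 + y0 z1 + y1 z0 - y1 z1\<close> on disjoint coordinates. Its norm is at
  most 4 since \<open>\<bar>x0 + x1\<bar> + \<bar>x0 - x1\<bar> \<le> 2\<close> on the unit ball. Its nonzero coefficients are all of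
  modulus one: two values of the first index, four of the second for each of these, and two of
  the third for each pair. Since the reciprocal exponents add up to 2, the mixed sum equals
  \<open>4 * 2 powr (1/q2)\<close>.
\<close>


section \<open>Averages over independent signs\<close>

text \<open>The average of \<open>F\<close> over all sign vectors with entries \<open>1\<close> and \<open>-1\<close> at the indices below \<open>n\<close>. The
  recursion fixes the sign with the largest index first; entries from \<open>n\<close> onwards stay \<open>0\<close>, so
  that pointwise facts about \<open>F\<close> may use only the entries below \<open>n\<close>.\<close>

primrec rad_avg :: "nat \<Rightarrow> ((nat \<Rightarrow> real) \<Rightarrow> real) \<Rightarrow> real" where
  "rad_avg 0 F = F (\<lambda>_. 0)"
| "rad_avg (Suc n) F = (rad_avg n (\<lambda>e. F (e(n := 1))) + rad_avg n (\<lambda>e. F (e(n := -1)))) / 2"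

lemma rad_avg_mono:
  assumes "\<And>e. (\<And>k. k < n \<Longrightarrow> e k \<in> {1, -1}) \<Longrightarrow> F e \<le> G e"
  shows "rad_avg n F \<le> rad_avg n G"
  using assms
proof (induction n arbitrary: F G)
  case (Suc n)
  have "rad_avg n (\<lambda>e. F (e(n := c))) \<le> rad_avg n (\<lambda>e. G (e(n := c)))" if "c \<in> {1, -1}" for c
    using that by (intro Suc.IH Suc.prems) (auto simp: less_Suc_eq)
  from this[of 1] this[of "-1"] show ?case by simp
qed simp

lemma rad_avg_cong:
  assumes "\<And>e. (\<And>k. k < n \<Longrightarrow> e k \<in> {1, -1}) \<Longrightarrow> F e = G e"
  shows "rad_avg n F = rad_avg n G"
  by (intro antisym rad_avg_mono) (simp_all add: assms)

lemma rad_avg_const [simp]: "rad_avg n (\<lambda>_. c) = c"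
  by (induction n) simp_all

lemma rad_avg_add: "rad_avg n (\<lambda>e. F e + G e) = rad_avg n F + rad_avg n G"
  by (induction n arbitrary: F G) (simp_all add: field_simps)

lemma rad_avg_cmult: "rad_avg n (\<lambda>e. c * F e) = c * rad_avg n F"
  by (induction n arbitrary: F) (simp_all add: field_simps)

lemma rad_avg_diff: "rad_avg n (\<lambda>e. F e - G e) = rad_avg n F - rad_avg n G"
  using rad_avg_add[of n F "\<lambda>e. -1 * G e"] unfolding rad_avg_cmult by simp

lemma rad_avg_divide: "rad_avg n (\<lambda>e. F e / c) = rad_avg n F / c"
  using rad_avg_cmult[of n "1 / c" F] by simp

lemma rad_avg_sum: "rad_avg n (\<lambda>e. \<Sum>i\<in>I. F i e) = (\<Sum>i\<in>I. rad_avg n (F i))"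
  by (induction I rule: infinite_finite_induct) (simp_all add: rad_avg_add)

text \<open>Any single sign can be averaged first, although the recursion singles out the last one. This is
  the only form in which independence of the signs is used.\<close>

lemma rad_avg_flip:
  "i < n \<Longrightarrow> rad_avg n F = rad_avg n (\<lambda>e. (F (e(i := 1)) + F (e(i := -1))) / 2)"
proof (induction n arbitrary: F)
  case (Suc n)
  show ?case
  proof (cases "i = n")
    case True
    then show ?thesis
      by (simp only: rad_avg.simps fun_upd_upd rad_avg_divide rad_avg_const rad_avg_add) simp
  next
    case False
    with Suc.prems have i: "i < n" by simp
    have "rad_avg n (\<lambda>e. F (e(n := c)))
        = rad_avg n (\<lambda>e. (F ((e(n := c))(i := 1)) + F ((e(n := c))(i := -1))) / 2)" for c
    proof -
      have tw: "(e(i := d))(n := c) = (e(n := c))(i := d)" for e :: "nat \<Rightarrow> real" and d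
        using False by (intro fun_upd_twist)
      show ?thesis using Suc.IH[OF i, of "\<lambda>e. F (e(n := c))"] unfolding tw .
    qed
    then show ?thesis by (simp only: rad_avg.simps)
  qed
qed simp

abbreviation (input) rad_sum :: "nat \<Rightarrow> (nat \<Rightarrow> real) \<Rightarrow> (nat \<Rightarrow> real) \<Rightarrow> real" where
  "rad_sum n a e \<equiv> (\<Sum>k<n. a k * e k)"

lemma rad_sum_upd:
  assumes "i < n"
  shows "rad_sum n a (e(i := c)) = (\<Sum>k\<in>{..<n} - {i}. a k * e k) + c * a i"
  using assms by (subst sum.remove[of _ i]) (auto intro!: sum.cong)


lemma rad_avg_square: "rad_avg n (\<lambda>e. (rad_sum n a e)\<^sup>2) = (\<Sum>k<n. (a k)\<^sup>2)"
proof -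
  have eq: "rad_avg n (\<lambda>e. a i * e i * rad_sum n a e) = (a i)\<^sup>2" if i: "i < n" for i
  proof -
    have "rad_avg n (\<lambda>e. a i * e i * rad_sum n a e) = rad_avg n (\<lambda>e. (a i)\<^sup>2)"
      by (subst rad_avg_flip[OF i], rule rad_avg_cong)
        (simp only: rad_sum_upd[OF i] fun_upd_same, simp add: field_simps power2_eq_square)
    then show ?thesis by simp
  qed
  have "rad_avg n (\<lambda>e. (rad_sum n a e)\<^sup>2) = rad_avg n (\<lambda>e. \<Sum>i<n. a i * e i * rad_sum n a e)"
    by (simp add: power2_eq_square sum_distrib_right)
  also have "\<dots> = (\<Sum>k<n. (a k)\<^sup>2)" unfolding rad_avg_sum by (intro sum.cong) (auto simp: eq)
  finally show ?thesis .
qed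

text \<open>Conditioning on the product of two signs: where \<open>e j = e i\<close> the two coefficients act as the single
  coefficient \<open>a i + a j\<close>, and where \<open>e j = - e i\<close> as \<open>a i - a j\<close>.\<close>

lemma rad_avg_split_pair:
  assumes i: "i < n" and j: "j < n" and ij: "i \<noteq> j"
  shows "rad_avg n (\<lambda>e. f (rad_sum n a e))
    = (rad_avg n (\<lambda>e. f (rad_sum n (a(i := a i + a j, j := 0)) e))
       + rad_avg n (\<lambda>e. f (rad_sum n (a(i := a i - a j, j := 0)) e))) / 2"
proof -
  have S: "rad_sum n (a(i := a i + c * a j, j := 0)) e = rad_sum n a (e(j := c * e i))" for c e
  proof -
    have *: "(\<Sum>k\<in>{..<n} - {j}. (a(i := d, j := 0)) k * e k)
        = d * e i + (\<Sum>k\<in>{..<n} - {j} - {i}. a k * e k)" for d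
      by (subst sum.remove[of _ i]) (use i ij in \<open>auto intro!: sum.cong\<close>)
    have **: "(\<Sum>k\<in>{..<n} - {j}. a k * e k)
        = a i * e i + (\<Sum>k\<in>{..<n} - {j} - {i}. a k * e k)"
      by (subst sum.remove[of _ i]) (use i ij in auto)
    have "rad_sum n (a(i := a i + c * a j, j := 0)) e
      = (\<Sum>k\<in>{..<n} - {j}. (a(i := a i + c * a j, j := 0)) k * e k)"
      by (subst sum.remove[of _ j]) (use j in auto)
    then show ?thesis unfolding rad_sum_upd[OF j] * ** by (simp add: algebra_simps)
  qed
  have "rad_avg n (\<lambda>e. f (rad_sum n a e))
      = rad_avg n (\<lambda>e. (f (rad_sum n a (e(j := 1 * e i))) + f (rad_sum n a (e(j := -1 * e i)))) / 2)"
  proof (subst rad_avg_flip[OF j], rule rad_avg_cong)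
    fix e :: "nat \<Rightarrow> real" assume "\<And>k. k < n \<Longrightarrow> e k \<in> {1, -1}"
    from this[OF i] show "(f (rad_sum n a (e(j := 1))) + f (rad_sum n a (e(j := -1)))) / 2
        = (f (rad_sum n a (e(j := 1 * e i))) + f (rad_sum n a (e(j := -1 * e i)))) / 2"
      by (auto simp del: fun_upd_apply)
  qed
  also have "\<dots> = (rad_avg n (\<lambda>e. f (rad_sum n (a(i := a i + a j, j := 0)) e))
       + rad_avg n (\<lambda>e. f (rad_sum n (a(i := a i - a j, j := 0)) e))) / 2"
    unfolding rad_avg_divide rad_avg_add S[symmetric] by simp
  finally show ?thesis .
qed

section \<open>A Stein inequality for Rademacher sums\<close>

text \<open>Expand \<open>S * G S\<close> as the sum of \<open>a i * e i * G S\<close> and average each term over \<open>e i\<close> first. With \<open>T\<close>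
  the part of \<open>S\<close> without index \<open>i\<close>, \<open>x = \<bar>a i\<bar> + T\<close> and \<open>y = \<bar>a i\<bar> - T\<close>, the two values of
  \<open>\<bar>S\<bar>\<close> are \<open>\<bar>x\<bar>\<close> and \<open>\<bar>y\<bar>\<close>, and the term becomes \<open>(a i)\<^sup>2 * (G x + G y) / (x + y)\<close> because \<open>G\<close> is odd.
  The remaining \<open>\<Phi> S - S * G S\<close> is distributed over the indices with the weights \<open>(a i)\<^sup>2\<close>.
  The free choice of \<open>G\<close> is what makes the bound strong.\<close>

lemma stein_bound:
  fixes \<Phi> G :: "real \<Rightarrow> real"
  assumes even: "\<And>s. \<Phi> (- s) = \<Phi> s" and odd: "\<And>s. G (- s) = - G s"
    and a: "(\<Sum>k<n. (a k)\<^sup>2) = 1"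
    and hyp: "\<And>i x y. i < n \<Longrightarrow> a i \<noteq> 0 \<Longrightarrow> x + y = 2 * \<bar>a i\<bar> \<Longrightarrow>
      k i \<le> (\<Phi> x - x * G x + (\<Phi> y - y * G y)) / 2 + (G x + G y) / (x + y)"
  shows "(\<Sum>i<n. (a i)\<^sup>2 * k i) \<le> rad_avg n (\<lambda>e. \<Phi> (rad_sum n a e))"
proof -
  define F where "F i e = (a i)\<^sup>2 * (\<Phi> (rad_sum n a e) - rad_sum n a e * G (rad_sum n a e))
      + a i * e i * G (rad_sum n a e)" for i and e :: "nat \<Rightarrow> real"
  have "(a i)\<^sup>2 * k i \<le> rad_avg n (F i)" if i: "i < n" for i
  proof (cases "a i = 0")
    case True
    then have "F i = (\<lambda>_. 0)" by (simp add: F_def fun_eq_iff)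
    with True show ?thesis by simp
  next
    case False
    have "(a i)\<^sup>2 * k i \<le> (F i (e(i := 1)) + F i (e(i := -1))) / 2" for e
    proof -
      define T where "T = (\<Sum>k\<in>{..<n} - {i}. a k * e k)"
      define x y where "x = \<bar>a i\<bar> + T" and "y = \<bar>a i\<bar> - T"
      have xy: "x + y = 2 * \<bar>a i\<bar>" by (simp add: x_def y_def)
      have "(a i)\<^sup>2 * k i \<le> (a i)\<^sup>2 * ((\<Phi> x - x * G x + (\<Phi> y - y * G y)) / 2 + (G x + G y) / (x + y))"
        using hyp[OF i False xy] by (intro mult_left_mono) auto
      also have "\<dots> = (a i)\<^sup>2 * ((\<Phi> x - x * G x + (\<Phi> y - y * G y)) / 2) + \<bar>a i\<bar> * ((G x + G y) / 2)"
        using False unfolding xy by (simp add: field_simps power2_eq_square)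
      also have "\<dots> = (F i (e(i := 1)) + F i (e(i := -1))) / 2"
      proof (cases "a i > 0")
        case True
        have T: "T + 1 * a i = x" "T + - 1 * a i = - y" using True by (auto simp: x_def y_def)
        from True show ?thesis
          unfolding F_def rad_sum_upd[OF i] T_def[symmetric] T fun_upd_same
          by (simp add: even odd field_simps)
      next
        case False
        have T: "T + 1 * a i = - y" "T + - 1 * a i = x" using False by (auto simp: x_def y_def)
        from False show ?thesis
          unfolding F_def rad_sum_upd[OF i] T_def[symmetric] T fun_upd_same
          by (simp add: even odd field_simps)
      qed
      finally show ?thesis .
    qed
    then have "rad_avg n (\<lambda>_. (a i)\<^sup>2 * k i) \<le> rad_avg n (\<lambda>e. (F i (e(i := 1)) + F i (e(i := -1))) / 2)"
      by (intro rad_avg_mono)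
    then show ?thesis using rad_avg_flip[OF i, of "F i"] by simp
  qed
  then have "(\<Sum>i<n. (a i)\<^sup>2 * k i) \<le> (\<Sum>i<n. rad_avg n (F i))"
    by (intro sum_mono) simp
  also have "\<dots> = rad_avg n (\<lambda>e. \<Sum>i<n. F i e)" by (simp add: rad_avg_sum)
  also have "(\<lambda>e. \<Sum>i<n. F i e) = (\<lambda>e. \<Phi> (rad_sum n a e))"
  proof
    fix e
    show "(\<Sum>i<n. F i e) = \<Phi> (rad_sum n a e)"
      unfolding F_def by (simp only: sum.distrib sum_distrib_right[symmetric] a) simp
  qed
  finally show ?thesis .
qed

text \<open>Stein's inequality for \<open>\<Phi> s = 2 * \<bar>s\<bar> - \<bar>s\<bar> ^ 3\<close>, with \<open>G\<close> chosen to cancel the cube.\<close>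

lemma rad_avg_abs_cube_le:
  assumes a: "(\<Sum>k<n. (a k)\<^sup>2) = 1"
  shows "rad_avg n (\<lambda>e. \<bar>rad_sum n a e\<bar> ^ 3) \<le> 2 * rad_avg n (\<lambda>e. \<bar>rad_sum n a e\<bar>)"
proof -
  have "(\<Sum>i<n. (a i)\<^sup>2 * 0) \<le> rad_avg n (\<lambda>e. (\<lambda>s. 2 * \<bar>s\<bar> - \<bar>s\<bar> ^ 3) (rad_sum n a e))"
  proof (rule stein_bound[where G = "\<lambda>s. - s * \<bar>s\<bar>"])
    fix i x y assume "a i \<noteq> 0" and "x + y = 2 * \<bar>a i\<bar>"
    then have pos: "x + y > 0" by simp
    have "x * \<bar>x\<bar> + y * \<bar>y\<bar> \<le> (\<bar>x\<bar> + \<bar>y\<bar>) * (x + y)"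
    proof -
      have "(\<bar>x\<bar> + \<bar>y\<bar>) * (x + y) - (x * \<bar>x\<bar> + y * \<bar>y\<bar>) = \<bar>x\<bar> * y + \<bar>y\<bar> * x"
        by (simp add: algebra_simps)
      also have "\<dots> \<ge> 0"
        using pos by (cases "x \<ge> 0"; cases "y \<ge> 0") (auto simp: algebra_simps)
      finally show ?thesis by simp
    qed
    then have le: "(x * \<bar>x\<bar> + y * \<bar>y\<bar>) / (x + y) \<le> \<bar>x\<bar> + \<bar>y\<bar>"
      using pos by (simp add: divide_le_eq)
    define r where "r = (x * \<bar>x\<bar> + y * \<bar>y\<bar>) / (x + y)"
    have \<psi>: "2 * \<bar>s\<bar> - \<bar>s\<bar> ^ 3 - s * (- s * \<bar>s\<bar>) = 2 * \<bar>s\<bar>" for s :: real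
      by (simp add: power3_eq_cube abs_mult_self_eq flip: mult.assoc)
    have minus: "(- x * \<bar>x\<bar> + - y * \<bar>y\<bar>) / (x + y) = - ((x * \<bar>x\<bar> + y * \<bar>y\<bar>) / (x + y))"
      unfolding minus_divide_left by (rule arg_cong[of _ _ "\<lambda>t. t / (x + y)"]) simp
    show "0 \<le> (2 * \<bar>x\<bar> - \<bar>x\<bar> ^ 3 - x * (- x * \<bar>x\<bar>)
        + (2 * \<bar>y\<bar> - \<bar>y\<bar> ^ 3 - y * (- y * \<bar>y\<bar>))) / 2 + (- x * \<bar>x\<bar> + - y * \<bar>y\<bar>) / (x + y)"
      unfolding \<psi> minus r_def[symmetric] using le[folded r_def] by (simp add: add_divide_distrib)
  qed (use a in auto)
  then show ?thesis by (simp add: rad_avg_diff rad_avg_cmult)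
qed

lemma abs_coeff_le_rad_avg:
  assumes i: "i < n"
  shows "\<bar>a i\<bar> \<le> rad_avg n (\<lambda>e. \<bar>rad_sum n a e\<bar>)"
proof -
  have "rad_avg n (\<lambda>_. \<bar>a i\<bar>)
      \<le> rad_avg n (\<lambda>e. (\<bar>rad_sum n a (e(i := 1))\<bar> + \<bar>rad_sum n a (e(i := -1))\<bar>) / 2)"
    unfolding rad_sum_upd[OF i] by (intro rad_avg_mono) simp
  then show ?thesis using rad_avg_flip[OF i, of "\<lambda>e. \<bar>rad_sum n a e\<bar>"] by simp
qed


text \<open>The coefficients are tuned so that, in combination with \<open>rad_avg_abs_cube_le\<close>, the resulting lower
  bound exceeds \<open>2 powr (-1/3)\<close> as soon as the first absolute moment is at least \<open>37/50\<close>. In the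
  variable \<open>w = s powr (1/3)\<close> the claim is that a polynomial of degree 9 is nonnegative on the
  half-line; the certificate \<open>A + w * B\<close> with sums of squares \<open>A\<close> and \<open>B\<close> comes from semidefinite
  programming, after rounding to rational numbers.\<close>

lemma cubic_minorant_powr:
  assumes "s \<ge> (0::real)"
  shows "- 33/2000 + 271/500 * s + 71/125 * s\<^sup>2 - 107/1000 * s ^ 3 \<le> s powr (4/3)"
proof -
  define w where "w = s powr (1/3)"
  have w: "w \<ge> 0" by (simp add: w_def)
  have w3: "w ^ 3 = s" and w4: "w ^ 4 = s powr (4/3)"
    using assms by (auto simp: w_def powr_realpow' powr_powr simp flip: powr_numeral)
  let ?A = "1/1650000 * (165 - 1149*w + 2387*w^2 - 1725*w^3 + 352*w^4)\<^sup>2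
    + 1/193865650000 * (352483*w - 1133869*w^2 + 1017485*w^3 - 255519*w^4)\<^sup>2
    + 1/9468519957922245000 * (1790823001*w^2 - 4045265250*w^3 + 2144560331*w^4)\<^sup>2
    + 7/322848355220048623817500 * (72111728527*w^3 - 62299027162*w^4)\<^sup>2
    + 177595665603/721117285270000 * (w^4)\<^sup>2"
  let ?B = "1/5745000 * (1149 - 4796*w + 6279*w^2 - 2809*w^3 + 202*w^4)\<^sup>2
    + 1/24266529555000 * (4223939*w - 11459034*w^2 + 7694914*w^3 - 796072*w^4)\<^sup>2
    + 1/53181435129294300000 * (2518096740*w^2 - 3688425043*w^3 + 1320116054*w^4)\<^sup>2
    + 1/9143312574267314703300000 * (726208205509*w^3 - 607378357502*w^4)\<^sup>2
    + 483383852291/726208205509000 * (w^4)\<^sup>2"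
  have "w ^ 4 + 33/2000 - 271/500 * w^3 - 71/125 * w^6 + 107/1000 * w^9 = ?A + w * ?B"
    by (simp add: power2_eq_square power3_eq_cube algebra_simps power_numeral_reduce)
  moreover have "0 \<le> ?A + w * ?B"
    using w by (intro add_nonneg_nonneg mult_nonneg_nonneg) auto
  moreover have "w ^ 6 = s\<^sup>2" "w ^ 9 = s ^ 3"
    by (simp_all add: w3[symmetric] flip: power_mult)
  ultimately show ?thesis unfolding w3 w4[symmetric] by linarith
qed

text \<open>This is \<open>stein_five_thirds\<close> in symmetric coordinates. For \<open>x = w ^ 3\<close> and \<open>y = z ^ 3\<close> the
  inequality is symmetric in \<open>w\<close> and \<open>z\<close> and invariant under a common change of sign, hence a
  polynomial in \<open>E = (w + z)\<^sup>2\<close> and \<open>p = w * z\<close>; here \<open>q\<close> is \<open>w\<^sup>2 - w * z + z\<^sup>2\<close> and \<open>s\<close> is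
  \<open>w\<^sup>2 + z\<^sup>2\<close>. The certificate \<open>E * A + (E - 4 * p) * B\<close> with sums of squares \<open>A\<close> and \<open>B\<close> comes from
  semidefinite programming, after rounding to rational numbers.\<close>

lemma quintic_nonneg:
  fixes E p :: real
  assumes "0 \<le> E" "4 * p \<le> E"
  defines "q \<equiv> E - 3 * p" and "s \<equiv> E - 2 * p"
  shows "0 \<le> q * (1/2 * (s\<^sup>2 - 2 * p\<^sup>2) - 871/2000 * (s^3 - 3 * s * p\<^sup>2)
     + 31/250 * ((s\<^sup>2 - 2 * p\<^sup>2)\<^sup>2 - 2 * p^4) + 871/1000 - 8136/10000 - 31/125 * s
     + 1/80 * E * q\<^sup>2) + 31/125 * p\<^sup>2"
proof -
  let ?A = "1/22960000 * (574 - 1150*E + 3360*p + 525*E^2 - 2850*(E*p) + 3310*p^2)\<^sup>2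
    + 1/342126960000 * (149010*E - 622692*p - 107807*E^2 + 637144*(E*p) - 793180*p^2)\<^sup>2
    + 1/6531133731040000 * (32872628*p - 952592*E^2 - 13815366*(E*p) + 53911545*p^2)\<^sup>2
    + 1/34452385188240504000 * (174676153*E^2 - 557795405*(E*p) - 889584319*p^2)\<^sup>2
    + 1/16972203691383320896000 * (6072739252*(E*p) - 11472771709*p^2)\<^sup>2
    + 18041325809/97163828032000 * (p^2)\<^sup>2"
  let ?B = "1/17220000 * (861 - 1905*E + 3100*p + 980*E^2 - 3790*(E*p) + 1745*p^2)\<^sup>2
    + 1/56017808000 * (48796*E - 4943*p - 34251*E^2 + 71719*(E*p) - 3393*p^2)\<^sup>2
    + 1/5826005251440000 * (9949595*p + 471331*E^2 - 11935595*(E*p) + 7134991*p^2)\<^sup>2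
    + 1/1567455694042560000 * (19692456*E^2 - 59072740*(E*p) + 3123651*p^2)\<^sup>2
    + 1/3254892323684736000 * (82643128*(E*p) + 15405879*p^2)\<^sup>2
    + 38754541/264458009600 * (p^2)\<^sup>2"
  have "q * (1/2 * (s\<^sup>2 - 2 * p\<^sup>2) - 871/2000 * (s^3 - 3 * s * p\<^sup>2)
     + 31/250 * ((s\<^sup>2 - 2 * p\<^sup>2)\<^sup>2 - 2 * p^4) + 871/1000 - 8136/10000 - 31/125 * s
     + 1/80 * E * q\<^sup>2) + 31/125 * p\<^sup>2 = E * ?A + (E - 4 * p) * ?B"
    unfolding q_def s_def
    by (simp add: power2_eq_square power3_eq_cube algebra_simps power_numeral_reduce
      add_divide_distrib diff_divide_distrib)
  also have "\<dots> \<ge> 0"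
    using assms(1,2) by (intro add_nonneg_nonneg mult_nonneg_nonneg) auto
  finally show ?thesis .
qed

lemma abs_powr_four_thirds: "\<bar>x\<bar> powr (4/3) = root 3 x ^ 4" for x :: real
proof (cases "x = 0")
  case False
  have "\<bar>x\<bar> powr (4/3) = (\<bar>x\<bar> powr (1/3)) powr 4" by (simp add: powr_powr)
  also have "\<bar>x\<bar> powr (1/3) = \<bar>root 3 x\<bar>"
    using False root_powr_inverse[of 3 "\<bar>x\<bar>"] by (simp add: real_root_abs)
  also have "\<bar>root 3 x\<bar> powr 4 = root 3 x ^ 4"
    using False powr_realpow[of "\<bar>root 3 x\<bar>" 4] by (simp add: power_even_abs)
  finally show ?thesis .
qed simp

text \<open>The hypothesis of \<open>stein_bound\<close> for \<open>\<Phi> s = \<bar>s\<bar> powr (4/3)\<close>, where \<open>(x + y) / 2\<close> is the modulus of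
  the coefficient. For \<open>G\<close> of this shape a bound independent of the coefficient stays below
  \<open>2 powr (-1/3)\<close>; the correction \<open>- ((x + y) / 2)\<^sup>2 / 20\<close> permits a constant term that exceeds this value by enough
  to cover the case in which the fourth powers of the coefficients have a small sum. The
  numerical values nearly maximize the resulting lower bound \<open>8136/10000 - (\<Sum> (a k) ^ 4) / 20\<close>
  at \<open>\<Sum> (a k) ^ 4 = 392/1000\<close>.\<close>

lemma stein_five_thirds:
  fixes x y :: real
  assumes pos: "x + y > 0"
  defines "G \<equiv> \<lambda>s. 871/1000 * s - 31/125 * root 3 s ^ 5"
  shows "8136/10000 - 1/20 * ((x + y) / 2)\<^sup>2
    \<le> (\<bar>x\<bar> powr (4/3) - x * G x + (\<bar>y\<bar> powr (4/3) - y * G y)) / 2 + (G x + G y) / (x + y)"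
proof -
  define w z where "w = root 3 x" and "z = root 3 y"
  have x: "x = w ^ 3" and y: "y = z ^ 3"
    by (simp_all add: w_def z_def odd_real_root_pow)
  define E p where "E = (w + z)\<^sup>2" and "p = w * z"
  define q s where "q = E - 3 * p" and "s = E - 2 * p"
  have q_eq: "q = w\<^sup>2 - w * z + z\<^sup>2" and s_eq: "s = w\<^sup>2 + z\<^sup>2"
    by (simp_all add: q_def s_def E_def p_def power2_eq_square algebra_simps)
  have xy: "x + y = (w + z) * q"
    unfolding x y q_eq by (simp add: power2_eq_square power3_eq_cube algebra_simps)
  have "E \<ge> 0" by (simp add: E_def)
  moreover have "E - 4 * p = (w - z)\<^sup>2"
    by (simp add: E_def p_def power2_eq_square algebra_simps)
  then have "4 * p \<le> E" by (smt (verit) zero_le_power2)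
  moreover have "q > 0"
  proof -
    have "q \<ge> 0" using calculation unfolding q_def by linarith
    then show ?thesis using pos xy by (cases "q = 0") auto
  qed
  define M where "M = 1/2 * (s\<^sup>2 - 2 * p\<^sup>2) - 871/2000 * (s^3 - 3 * s * p\<^sup>2)
     + 31/250 * ((s\<^sup>2 - 2 * p\<^sup>2)\<^sup>2 - 2 * p^4) + 871/1000 - 8136/10000 - 31/125 * s
     + 1/80 * E * q\<^sup>2"
  have "0 \<le> q * M + 31/125 * p\<^sup>2"
    using quintic_nonneg[OF calculation] unfolding M_def q_def s_def .
  then have M: "0 \<le> M + 31/125 * (p\<^sup>2 / q)"
    using \<open>q > 0\<close> by (simp add: field_simps)
  have "G x + G y = (871/1000 - 31/125 * (s - p\<^sup>2 / q)) * (x + y)"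
  proof -
    have "(s - p\<^sup>2 / q) * (x + y) = (s * q - p\<^sup>2) * (w + z)"
      unfolding xy using \<open>q > 0\<close> by (simp add: field_simps)
    also have "\<dots> = w ^ 5 + z ^ 5"
      unfolding s_eq q_eq p_def by (simp add: algebra_simps power2_eq_square power_numeral_reduce)
    finally have *: "(s - p\<^sup>2 / q) * (x + y) = w ^ 5 + z ^ 5" .
    have "G x + G y = 871/1000 * (x + y) - 31/125 * (w ^ 5 + z ^ 5)"
      unfolding G_def w_def[symmetric] z_def[symmetric] by (simp add: algebra_simps add_divide_distrib)
    also have "\<dots> = (871/1000 - 31/125 * (s - p\<^sup>2 / q)) * (x + y)"
      unfolding *[symmetric] by (simp only: left_diff_distrib mult.assoc)
    finally show ?thesis .
  qed
  then have G: "(G x + G y) / (x + y) = 871/1000 - 31/125 * (s - p\<^sup>2 / q)"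
    using pos by simp
  have Gxy: "G x = 871/1000 * w ^ 3 - 31/125 * w ^ 5" "G y = 871/1000 * z ^ 3 - 31/125 * z ^ 5"
    unfolding G_def w_def[symmetric] z_def[symmetric] by (simp_all add: x y)
  have "w ^ 4 + z ^ 4 = s\<^sup>2 - 2 * p\<^sup>2"
    "x * G x + y * G y = 871/1000 * (s^3 - 3 * s * p\<^sup>2)
       - 31/125 * ((s\<^sup>2 - 2 * p\<^sup>2)\<^sup>2 - 2 * p^4)"
    unfolding Gxy unfolding x y s_eq p_def
    by (simp_all add: algebra_simps power2_eq_square power3_eq_cube power_numeral_reduce)
  moreover have "((x + y) / 2)\<^sup>2 = E * q\<^sup>2 / 4"
    unfolding xy E_def by (simp add: power_mult_distrib power_divide)
  ultimately show ?thesis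
    using M unfolding G M_def abs_powr_four_thirds w_def[symmetric] z_def[symmetric]
    by (simp add: field_simps)
qed

text \<open>The number \<open>7938/10000\<close> is a rational upper bound for \<open>2 powr (-1/3)\<close>.\<close>

lemma rad_avg_four_thirds_large_coeff:
  assumes a: "(\<Sum>k<n. (a k)\<^sup>2) = 1" and i: "i < n" and large: "37/50 \<le> \<bar>a i\<bar>"
  shows "7938/10000 \<le> rad_avg n (\<lambda>e. \<bar>rad_sum n a e\<bar> powr (4/3))"
proof -
  let ?m = "rad_avg n (\<lambda>e. \<bar>rad_sum n a e\<bar>)"
  have "rad_avg n (\<lambda>e. - 33/2000 + 271/500 * \<bar>rad_sum n a e\<bar> + 71/125 * (rad_sum n a e)\<^sup>2
      - 107/1000 * \<bar>rad_sum n a e\<bar> ^ 3) \<le> rad_avg n (\<lambda>e. \<bar>rad_sum n a e\<bar> powr (4/3))"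
    using cubic_minorant_powr[OF abs_ge_zero] by (intro rad_avg_mono) simp
  then have "- 33/2000 + 271/500 * ?m + 71/125 - 107/1000 * rad_avg n (\<lambda>e. \<bar>rad_sum n a e\<bar> ^ 3)
      \<le> rad_avg n (\<lambda>e. \<bar>rad_sum n a e\<bar> powr (4/3))"
    by (simp add: rad_avg_add rad_avg_diff rad_avg_cmult rad_avg_square a
        del: times_divide_eq_left)
  moreover have "37/50 \<le> ?m" using abs_coeff_le_rad_avg[OF i, of a] large by linarith
  ultimately show ?thesis using rad_avg_abs_cube_le[OF a] by linarith
qed

lemma rad_avg_four_thirds_spread:
  assumes a: "(\<Sum>k<n. (a k)\<^sup>2) = 1" and spread: "(\<Sum>k<n. (a k) ^ 4) \<le> 392/1000"
  shows "7938/10000 \<le> rad_avg n (\<lambda>e. \<bar>rad_sum n a e\<bar> powr (4/3))"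
proof -
  have "(\<Sum>i<n. (a i)\<^sup>2 * (8136/10000 - 1/20 * (a i)\<^sup>2))
      \<le> rad_avg n (\<lambda>e. (\<lambda>s. \<bar>s\<bar> powr (4/3)) (rad_sum n a e))"
  proof (rule stein_bound[where G = "\<lambda>s. 871/1000 * s - 31/125 * root 3 s ^ 5"])
    fix i x y assume "a i \<noteq> 0" and xy: "x + y = 2 * \<bar>a i\<bar>"
    then have "x + y > 0" by simp
    from stein_five_thirds[OF this] show "8136/10000 - 1/20 * (a i)\<^sup>2
      \<le> (\<bar>x\<bar> powr (4/3) - x * (871/1000 * x - 31/125 * root 3 x ^ 5)
          + (\<bar>y\<bar> powr (4/3) - y * (871/1000 * y - 31/125 * root 3 y ^ 5))) / 2
        + (871/1000 * x - 31/125 * root 3 x ^ 5 + (871/1000 * y - 31/125 * root 3 y ^ 5)) / (x + y)"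
      unfolding xy by simp
  qed (use a in \<open>auto simp: real_root_minus algebra_simps\<close>)
  moreover have "(\<Sum>i<n. (a i)\<^sup>2 * (8136/10000 - 1/20 * (a i)\<^sup>2))
      = 8136/10000 * (\<Sum>k<n. (a k)\<^sup>2) - 1/20 * (\<Sum>k<n. (a k) ^ 4)"
    unfolding sum_distrib_left sum_subtractf[symmetric]
    by (intro sum.cong refl) (simp add: algebra_simps power2_eq_square power4_eq_xxxx)
  ultimately show ?thesis using a spread by simp
qed

section \<open>The sharp Khinchine inequalities for the exponents 4/3 and 1\<close>

lemma le_powr_two_thirds:
  fixes u v :: real
  assumes "0 \<le> v" "u ^ 3 \<le> v\<^sup>2"
  shows "u \<le> v powr (2/3)"
proof -
  have "(v powr (2/3)) ^ 3 = v\<^sup>2"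
    using assms(1) by (cases "v = 0") (simp_all add: powr_powr flip: powr_numeral)
  with assms(2) have "u ^ 3 \<le> (v powr (2/3)) ^ 3" by simp
  then show ?thesis by (intro power_le_imp_le_base[of u 2]) simp_all
qed

lemma midpoint_powr_le:
  fixes x y p :: real
  assumes "x \<ge> 0" "y \<ge> 0" "p \<ge> 1"
  shows "((x + y) / 2) powr p \<le> (x powr p + y powr p) / 2"
proof -
  have half: "(t / 2) powr p \<le> t powr p / 2" if "t \<ge> 0" for t :: real
  proof -
    have "2 \<le> 2 powr p" using powr_mono[of 1 p 2] assms(3) by simp
    then have "t powr p * 2 \<le> t powr p * 2 powr p" by (intro mult_left_mono) simp_all
    then show ?thesis using that by (simp add: powr_divide field_simps)
  qed
  show ?thesis
  proof (cases "x = 0 \<or> y = 0")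
    case True
    then show ?thesis using half assms by auto
  next
    case False
    then show ?thesis
      using convex_onD[OF powr_convex[OF assms(3)], of "1/2" x y] assms
      by (simp add: add_divide_distrib)
  qed
qed

text \<open>For each fixed value \<open>T\<close> of the other terms, convexity gives
  \<open>\<bar>a i\<bar> powr p \<le> (\<bar>T + a i\<bar> powr p + \<bar>T - a i\<bar> powr p) / 2\<close>.\<close>

lemma abs_coeff_powr_le_rad_avg:
  assumes i: "i < n" and p: "p \<ge> 1"
  shows "\<bar>a i\<bar> powr p \<le> rad_avg n (\<lambda>e. \<bar>rad_sum n a e\<bar> powr p)"
proof -
  have *: "\<bar>b\<bar> powr p \<le> (\<bar>T + b\<bar> powr p + \<bar>T - b\<bar> powr p) / 2" for T b :: real
  proof -
    have "\<bar>b\<bar> powr p \<le> ((\<bar>T + b\<bar> + \<bar>T - b\<bar>) / 2) powr p"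
      using p by (intro powr_mono2) auto
    also have "\<dots> \<le> (\<bar>T + b\<bar> powr p + \<bar>T - b\<bar> powr p) / 2"
      using p by (intro midpoint_powr_le) auto
    finally show ?thesis .
  qed
  have "rad_avg n (\<lambda>_. \<bar>a i\<bar> powr p)
      \<le> rad_avg n (\<lambda>e. (\<bar>rad_sum n a (e(i := 1))\<bar> powr p + \<bar>rad_sum n a (e(i := -1))\<bar> powr p) / 2)"
    unfolding rad_sum_upd[OF i] using *[of "a i"] by (intro rad_avg_mono) simp
  then show ?thesis using rad_avg_flip[OF i, of "\<lambda>e. \<bar>rad_sum n a e\<bar> powr p"] by simp
qed

text \<open>For coefficients of Euclidean norm 1 this is the average of \<open>\<bar>S\<bar> powr (4/3)\<close> in the extremal case
  of two equal coefficients, where \<open>\<bar>S\<bar>\<close> takes the values \<open>0\<close> and \<open>sqrt 2\<close> equally often.\<close>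

definition khinchine_const :: real where "khinchine_const = 2 powr (- 1/3)"

lemma khinchine_const_pos: "khinchine_const > 0" by (simp add: khinchine_const_def)

lemma khinchine_const_le: "khinchine_const \<le> 7938/10000"
proof (rule power_le_imp_le_base)
  have "khinchine_const ^ 3 = 1/2"
    using powr_powr[of 2 "- 1/3 :: real" 3] by (simp add: khinchine_const_def powr_minus_divide)
  then show "khinchine_const ^ Suc 2 \<le> (7938/10000) ^ Suc 2" by (simp add: eval_nat_numeral)
qed simp

lemma two_khinchine_const: "2 * khinchine_const = 2 powr (2/3)"
proof -
  have "2 * khinchine_const = 2 powr 1 * 2 powr (- 1/3)" by (simp add: khinchine_const_def)
  also have "\<dots> = 2 powr (2/3)" unfolding powr_add[symmetric] by simp
  finally show ?thesis .
qed

text \<open>For \<open>U = 2 - 2 * W\<close> this says \<open>1 \<le> (1 - W) powr (2/3) + W powr (2/3) / 2\<close>, with equality at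
  \<open>W = 0\<close>. The right-hand side is concave and exceeds 1 slightly at \<open>W = 1/3\<close>; both powers are
  compared with linear functions whose slopes cancel.\<close>

lemma pair_inequality:
  assumes "0 \<le> W" "W \<le> 1/3" "2 - 2 * W \<le> U"
  shows "2 * khinchine_const \<le> U powr (2/3) + khinchine_const * W powr (2/3)"
proof -
  have "(1 - 72/100 * W) ^ 3 \<le> (1 - W)\<^sup>2"
  proof -
    have "0 \<le> (W - 1/3)\<^sup>2" by simp
    then have "2/3 * W - 1/9 \<le> W\<^sup>2" by (simp add: power2_eq_square algebra_simps)
    then have "0 \<le> W * (4/25 - 347/625 * W + 5832/15625 * W\<^sup>2)"
      using assms by (intro mult_nonneg_nonneg) auto
    also have "\<dots> = (1 - W)\<^sup>2 - (1 - 72/100 * W) ^ 3"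
      by (simp add: power2_eq_square power3_eq_cube algebra_simps add_divide_distrib diff_divide_distrib)
    finally show ?thesis by simp
  qed
  then have 1: "1 - 72/100 * W \<le> (1 - W) powr (2/3)"
    using assms by (intro le_powr_two_thirds) auto
  have "(144/100 * W) ^ 3 \<le> W\<^sup>2"
  proof -
    have "W\<^sup>2 * ((144/100) ^ 3 * W) \<le> W\<^sup>2 * 1"
      using assms by (intro mult_left_mono) (auto simp: eval_nat_numeral)
    then show ?thesis by (simp add: power2_eq_square power3_eq_cube algebra_simps)
  qed
  then have 2: "144/100 * W \<le> W powr (2/3)"
    using assms by (intro le_powr_two_thirds) auto
  have "2 * khinchine_const * (1 - W) powr (2/3) = (2 - 2 * W) powr (2/3)"
    using assms powr_mult[of 2 "1 - W" "2/3"] unfolding two_khinchine_const by (simp add: algebra_simps)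
  also have "\<dots> \<le> U powr (2/3)" using assms by (intro powr_mono2) auto
  finally have "2 * khinchine_const * (1 - W) powr (2/3) \<le> U powr (2/3)" .
  moreover have "2 * khinchine_const * (1 - 72/100 * W) \<le> 2 * khinchine_const * (1 - W) powr (2/3)"
    using 1 khinchine_const_pos by (intro mult_left_mono) auto
  moreover have "khinchine_const * (144/100 * W) \<le> khinchine_const * W powr (2/3)"
    using 2 khinchine_const_pos by (intro mult_left_mono) auto
  ultimately show ?thesis by (simp add: algebra_simps)
qed

text \<open>If the largest \<open>A = (b i)\<^sup>2\<close> is at most \<open>39/100\<close>, the sum is at most \<open>A\<close>. Otherwise the pair
  condition bounds every other square by \<open>1 / (9 * A)\<close>, and the sum is at most
  \<open>A\<^sup>2 + (1 - A) / (9 * A)\<close>, a convex function of \<open>A\<close> which is small enough at both ends of the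
  remaining interval.\<close>

lemma sum_power4_le:
  fixes b :: "nat \<Rightarrow> real"
  assumes b: "(\<Sum>k<n. (b k)\<^sup>2) = 1"
    and small: "\<And>i. i < n \<Longrightarrow> \<bar>b i\<bar> < 37/50"
    and pairs: "\<And>i j. i < n \<Longrightarrow> j < n \<Longrightarrow> i \<noteq> j \<Longrightarrow> \<bar>b i * b j\<bar> < 1/3"
  shows "(\<Sum>k<n. (b k) ^ 4) \<le> 392/1000"
proof -
  have "n > 0" using b by (cases n) auto
  then have "finite ((\<lambda>k. \<bar>b k\<bar>) ` {..<n})" "(\<lambda>k. \<bar>b k\<bar>) ` {..<n} \<noteq> {}" by auto
  from Max_in[OF this] obtain i where i: "i < n" and "\<bar>b i\<bar> = Max ((\<lambda>k. \<bar>b k\<bar>) ` {..<n})" by force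
  then have max: "\<bar>b k\<bar> \<le> \<bar>b i\<bar>" if "k < n" for k using that by auto
  define A where "A = (b i)\<^sup>2"
  have max': "(b k)\<^sup>2 \<le> A" if "k < n" for k
    unfolding A_def using max[OF that] by (simp add: abs_le_square_iff)
  have pow4: "(b k) ^ 4 = (b k)\<^sup>2 * (b k)\<^sup>2" for k by (simp add: power2_eq_square power4_eq_xxxx)
  show ?thesis
  proof (cases "A \<le> 39/100")
    case True
    have "(\<Sum>k<n. (b k) ^ 4) \<le> (\<Sum>k<n. A * (b k)\<^sup>2)"
      unfolding pow4 using max' by (intro sum_mono mult_right_mono) auto
    also have "\<dots> = A" unfolding sum_distrib_left[symmetric] b by simp
    finally show ?thesis using True by simp
  next
    case False
    have A: "A \<le> 5476/10000"
      unfolding A_def using abs_le_square_iff[of "b i" "37/50"] small[OF i] by (simp add: power2_eq_square)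
    have rest: "(\<Sum>k\<in>{..<n} - {i}. (b k)\<^sup>2) = 1 - A"
      using b i unfolding A_def by (subst (asm) sum.remove[of _ i]) auto
    have le: "(b k)\<^sup>2 \<le> 1 / (9 * A)" if "k \<in> {..<n} - {i}" for k
    proof -
      have "\<bar>b i * b k\<bar>\<^sup>2 \<le> (1/3)\<^sup>2" using pairs[of i k] i that by (intro power_mono) auto
      then have "A * (b k)\<^sup>2 \<le> 1/9" by (simp add: A_def power_mult_distrib power_divide)
      then show ?thesis using False by (simp add: field_simps)
    qed
    have "(\<Sum>k<n. (b k) ^ 4) = A * A + (\<Sum>k\<in>{..<n} - {i}. (b k) ^ 4)"
      unfolding A_def pow4[of i, symmetric] using i by (intro sum.remove) auto
    also have "(\<Sum>k\<in>{..<n} - {i}. (b k) ^ 4) \<le> (\<Sum>k\<in>{..<n} - {i}. 1 / (9 * A) * (b k)\<^sup>2)"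
      unfolding pow4 using le by (intro sum_mono mult_right_mono) auto
    also have "\<dots> = 1 / (9 * A) * (1 - A)" unfolding rest[symmetric] sum_distrib_left ..
    also have "A * A + 1 / (9 * A) * (1 - A) \<le> 392/1000"
    proof -
      \<comment> \<open>the third factor makes the quadratic term vanish, so that the product differs from the required cubic by a linear function\<close>
      have "0 \<le> (A - 39/100) * (5476/10000 - A) * (A + 9376/10000)"
        using False A by (intro mult_nonneg_nonneg) auto
      also have "\<dots> = 66552976/100000000 * A - A ^ 3 - 2002376064/10000000000"
        by (simp add: power3_eq_cube field_simps)
      finally have "9 * A ^ 3 + (1 - A) \<le> 9 * A * (392/1000)"
        using False A by simp
      then have "(9 * A ^ 3 + (1 - A)) / (9 * A) \<le> 392/1000"
        using False by (subst pos_divide_le_eq) (auto simp: mult.commute)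
      moreover have "A * A + 1 / (9 * A) * (1 - A) = (9 * A ^ 3 + (1 - A)) / (9 * A)"
        using False by (simp add: field_simps power3_eq_cube)
      ultimately show ?thesis by simp
    qed
    finally show ?thesis by simp
  qed
qed


text \<open>After conditioning on the product of the two signs, the coefficient \<open>u\<close> with
  \<open>u\<^sup>2 = (\<bar>a i\<bar> + \<bar>a j\<bar>)\<^sup>2\<close> is so large that it alone gives the lower bound \<open>\<bar>u\<bar> powr (4/3)\<close>; the
  other half of the average has squared coefficient norm \<open>1 - 2 * \<bar>a i * a j\<bar>\<close> and fewer
  nonzero coefficients, so the induction hypothesis applies to it. \<open>pair_inequality\<close> adds the two.\<close>

lemma khinchine_pair_case:
  assumes a: "(\<Sum>k<n. (a k)\<^sup>2) = 1"
    and i: "i < n" and j: "j < n" and ij: "i \<noteq> j" and large: "1/3 \<le> \<bar>a i * a j\<bar>"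
    and IH: "\<And>d. khinchine_const * (\<Sum>k<n. ((a(i := d, j := 0)) k)\<^sup>2) powr (2/3)
      \<le> rad_avg n (\<lambda>e. \<bar>rad_sum n (a(i := d, j := 0)) e\<bar> powr (4/3))"
  shows "khinchine_const \<le> rad_avg n (\<lambda>e. \<bar>rad_sum n a e\<bar> powr (4/3))"
proof -
  define R where "R d = rad_avg n (\<lambda>e. \<bar>rad_sum n (a(i := d, j := 0)) e\<bar> powr (4/3))" for d
  have key: "2 * khinchine_const \<le> R u + R v"
    if u: "u\<^sup>2 = (a i)\<^sup>2 + (a j)\<^sup>2 + 2 * \<bar>a i * a j\<bar>"
      and v: "v\<^sup>2 = (a i)\<^sup>2 + (a j)\<^sup>2 - 2 * \<bar>a i * a j\<bar>" for u v
  proof -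
    have norm: "(\<Sum>k<n. ((a(i := v, j := 0)) k)\<^sup>2) = 1 - 2 * \<bar>a i * a j\<bar>"
    proof -
      have "1 = (a j)\<^sup>2 + ((a i)\<^sup>2 + (\<Sum>k\<in>{..<n} - {j} - {i}. (a k)\<^sup>2))"
        unfolding a[symmetric] using i j ij
        by (subst sum.remove[of _ j], simp, simp, subst sum.remove[of _ i]) auto
      moreover have "(\<Sum>k<n. ((a(i := v, j := 0)) k)\<^sup>2)
          = v\<^sup>2 + (\<Sum>k\<in>{..<n} - {j} - {i}. (a k)\<^sup>2)"
        using i j ij
        by (subst sum.remove[of _ j], simp, simp, subst sum.remove[of _ i]) (auto intro!: sum.cong)
      ultimately show ?thesis using v by simp
    qed
    have "0 \<le> 1 - 2 * \<bar>a i * a j\<bar>" unfolding norm[symmetric] by (intro sum_nonneg) simp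
    moreover have "0 \<le> (\<bar>a i\<bar> - \<bar>a j\<bar>)\<^sup>2" by simp
    then have "2 - 2 * (1 - 2 * \<bar>a i * a j\<bar>) \<le> u\<^sup>2"
      unfolding u by (simp add: power2_diff abs_mult)
    ultimately have "2 * khinchine_const \<le> (u\<^sup>2) powr (2/3) + khinchine_const * (1 - 2 * \<bar>a i * a j\<bar>) powr (2/3)"
      using large by (intro pair_inequality) auto
    moreover have "khinchine_const * (1 - 2 * \<bar>a i * a j\<bar>) powr (2/3) \<le> R v"
      using IH[of v] unfolding norm R_def .
    moreover have "(u\<^sup>2) powr (2/3) \<le> R u"
    proof -
      have "(u\<^sup>2) powr (2/3) = \<bar>u\<bar> powr (4/3)"
        using powr_powr[of "\<bar>u\<bar>" 2 "2/3"] by simp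
      also have "\<dots> \<le> R u"
        using abs_coeff_powr_le_rad_avg[OF i, of "4/3" "a(i := u, j := 0)"] ij
        unfolding R_def by simp
      finally show ?thesis .
    qed
    ultimately show ?thesis by linarith
  qed
  have "2 * khinchine_const \<le> R (a i + a j) + R (a i - a j)"
  proof (cases "a i * a j \<ge> 0")
    case True
    then show ?thesis by (intro key) (simp_all add: power2_sum power2_diff)
  next
    case False
    then have "2 * khinchine_const \<le> R (a i - a j) + R (a i + a j)"
      by (intro key) (simp_all add: power2_sum power2_diff)
    then show ?thesis by simp
  qed
  then show ?thesis
    unfolding rad_avg_split_pair[OF i j ij, of "\<lambda>s. \<bar>s\<bar> powr (4/3)" a] R_def by simp
qed

theorem khinchine_four_thirds:
  "khinchine_const * (\<Sum>k<n. (a k)\<^sup>2) powr (2/3) \<le> rad_avg n (\<lambda>e. \<bar>rad_sum n a e\<bar> powr (4/3))"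
proof (induction "card {k. k < n \<and> a k \<noteq> 0}" arbitrary: a rule: less_induct)
  case less
  define r where "r = sqrt (\<Sum>k<n. (a k)\<^sup>2)"
  have r2: "r\<^sup>2 = (\<Sum>k<n. (a k)\<^sup>2)" by (simp add: r_def sum_nonneg)
  show ?case
  proof (cases "r = 0")
    case True
    then have "rad_avg n (\<lambda>_. 0) \<le> rad_avg n (\<lambda>e. \<bar>rad_sum n a e\<bar> powr (4/3))"
      by (intro rad_avg_mono) simp
    then show ?thesis using True by (simp flip: r2)
  next
    case False
    moreover have "r \<ge> 0" unfolding r_def by (intro real_sqrt_ge_zero sum_nonneg) simp
    ultimately have r: "r > 0" by simp
    \<comment> \<open>normalization; it preserves the set of nonzero coefficients, on whose size the induction runs\<close>
    define b where "b k = a k / r" for k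
    have b: "(\<Sum>k<n. (b k)\<^sup>2) = 1"
    proof -
      have "(\<Sum>k<n. (b k)\<^sup>2) = (\<Sum>k<n. (a k)\<^sup>2) / r\<^sup>2"
        unfolding b_def power_divide sum_divide_distrib ..
      then show ?thesis using False unfolding r2[symmetric] by simp
    qed
    have supp: "{k. k < n \<and> b k \<noteq> 0} = {k. k < n \<and> a k \<noteq> 0}"
      using False by (auto simp: b_def)
    have "khinchine_const \<le> rad_avg n (\<lambda>e. \<bar>rad_sum n b e\<bar> powr (4/3))"
    proof (cases "(\<exists>i<n. 37/50 \<le> \<bar>b i\<bar>) \<or> (\<Sum>k<n. (b k) ^ 4) \<le> 392/1000")
      case True
      then have "7938/10000 \<le> rad_avg n (\<lambda>e. \<bar>rad_sum n b e\<bar> powr (4/3))"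
        using rad_avg_four_thirds_large_coeff[OF b] rad_avg_four_thirds_spread[OF b] by blast
      with khinchine_const_le show ?thesis by linarith
    next
      case False
      have "\<exists>i j. i < n \<and> j < n \<and> i \<noteq> j \<and> 1/3 \<le> \<bar>b i * b j\<bar>"
      proof (rule ccontr)
        assume *: "\<not> ?thesis"
        have "(\<Sum>k<n. (b k) ^ 4) \<le> 392/1000"
        proof (rule sum_power4_le[OF b])
          show "\<bar>b i\<bar> < 37/50" if "i < n" for i using False that by force
          show "\<bar>b i * b j\<bar> < 1/3" if "i < n" "j < n" "i \<noteq> j" for i j
            using * that by force
        qed
        with False show False by blast
      qed
      then obtain i j where i: "i < n" and j: "j < n" and ij: "i \<noteq> j"
        and large: "1/3 \<le> \<bar>b i * b j\<bar>"
        by blast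
      show ?thesis
      proof (rule khinchine_pair_case[OF b i j ij large])
        fix d
        have "b i \<noteq> 0" "b j \<noteq> 0" using large by auto
        then have "{k. k < n \<and> (b(i := d, j := 0)) k \<noteq> 0} \<subseteq> {k. k < n \<and> b k \<noteq> 0} - {j}"
          by (auto split: if_splits)
        also have "\<dots> \<subset> {k. k < n \<and> a k \<noteq> 0}"
          using \<open>b j \<noteq> 0\<close> j unfolding supp by (auto simp: b_def)
        finally have "card {k. k < n \<and> (b(i := d, j := 0)) k \<noteq> 0} < card {k. k < n \<and> a k \<noteq> 0}"
          by (rule psubset_card_mono[rotated]) simp
        then show "khinchine_const * (\<Sum>k<n. ((b(i := d, j := 0)) k)\<^sup>2) powr (2/3)
            \<le> rad_avg n (\<lambda>e. \<bar>rad_sum n (b(i := d, j := 0)) e\<bar> powr (4/3))"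
          by (rule less)
      qed
    qed
    then have "r powr (4/3) * khinchine_const \<le> r powr (4/3) * rad_avg n (\<lambda>e. \<bar>rad_sum n b e\<bar> powr (4/3))"
      by (intro mult_left_mono) auto
    also have "\<dots> = rad_avg n (\<lambda>e. (r * \<bar>rad_sum n b e\<bar>) powr (4/3))"
      using r by (simp add: powr_mult rad_avg_cmult)
    also have "(\<lambda>e. r * \<bar>rad_sum n b e\<bar>) = (\<lambda>e. \<bar>rad_sum n a e\<bar>)"
    proof
      fix e
      have "r * rad_sum n b e = rad_sum n a e"
        using False unfolding b_def sum_distrib_left by (intro sum.cong) auto
      then show "r * \<bar>rad_sum n b e\<bar> = \<bar>rad_sum n a e\<bar>" using r by (metis abs_mult abs_of_pos)
    qed
    also have "r powr (4/3) = (\<Sum>k<n. (a k)\<^sup>2) powr (2/3)"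
      using r powr_powr[of r 2 "2/3"] unfolding r2[symmetric] by simp
    finally show ?thesis by (simp add: mult.commute)
  qed
qed

text \<open>Follows from the exponent 4/3: by the inequality of arithmetic and geometric means
  \<open>\<bar>s\<bar> powr (4/3) = (\<bar>s\<bar> powr (2/3)) * (s\<^sup>2 powr (1/3))\<close> is at most a combination of \<open>\<bar>s\<bar>\<close> and \<open>s\<^sup>2\<close>,
  scaled to be an equality at \<open>\<bar>s\<bar> = sqrt 2 * r\<close>, the nonzero value in the extremal case. The average
  of \<open>s\<^sup>2\<close> is known, and the constants of the two sharp inequalities match.\<close>

lemma khinchine_one: "L2_set a {..<n} \<le> sqrt 2 * rad_avg n (\<lambda>e. \<bar>rad_sum n a e\<bar>)"
proof -
  define r where "r = L2_set a {..<n}"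
  let ?m = "rad_avg n (\<lambda>e. \<bar>rad_sum n a e\<bar>)"
  have r2: "r\<^sup>2 = (\<Sum>k<n. (a k)\<^sup>2)" by (simp add: r_def L2_set_def sum_nonneg)
  have "r \<le> sqrt 2 * ?m"
  proof (cases "r = 0")
    case True
    have "rad_avg n (\<lambda>_. 0) \<le> ?m" by (intro rad_avg_mono) simp
    with True show ?thesis by simp
  next
    case False
    moreover have "r \<ge> 0" by (simp add: r_def)
    ultimately have r: "r > 0" by simp
    define C where "C = khinchine_const * r powr (4/3)"
    have C: "C > 0" using r khinchine_const_pos by (simp add: C_def)
    have "3 * \<bar>s\<bar> powr (4/3) \<le> C * (2 * sqrt 2 / r * \<bar>s\<bar> + 1 / r\<^sup>2 * s\<^sup>2)" for s
    proof -
      \<comment> \<open>in this variable the claim becomes \<open>3 * y \<le> 2 + y ^ 3\<close>, with equality at \<open>y = 1\<close>\<close>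
      define y where "y = root 3 \<bar>s\<bar> / root 3 (sqrt 2 * r)"
      define b where "b = root 3 (sqrt 2 * r)"
      have b: "b > 0" "b ^ 3 = sqrt 2 * r" using r by (simp_all add: b_def)
      have y: "y \<ge> 0" using r by (simp add: y_def)
      have yb: "root 3 \<bar>s\<bar> = y * b"
        using b(1) unfolding y_def b_def[symmetric] by simp
      have s: "\<bar>s\<bar> = y ^ 3 * (sqrt 2 * r)"
        using arg_cong[OF yb, of "\<lambda>t. t ^ 3"] b by (simp add: power_mult_distrib)
      have "\<bar>s\<bar> powr (4/3) = (y * b) ^ 4"
        using abs_powr_four_thirds[of "\<bar>s\<bar>"] yb by simp
      also have "b ^ 4 = 2 * C"
      proof -
        have "b ^ 4 = (sqrt 2 * r) powr (4/3)"
          using abs_powr_four_thirds[of "sqrt 2 * r"] r by (simp add: b_def abs_mult)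
        also have "\<dots> = (2 powr (1/2)) powr (4/3) * r powr (4/3)"
          using r by (simp add: powr_mult powr_half_sqrt)
        also have "(2 powr (1/2)) powr (4/3) = (2 * khinchine_const :: real)" by (simp add: two_khinchine_const powr_powr)
        finally show ?thesis by (simp add: C_def)
      qed
      then have "(y * b) ^ 4 = y ^ 4 * (2 * C)" by (simp add: power_mult_distrib)
      finally have 1: "3 * \<bar>s\<bar> powr (4/3) = C * (y ^ 3 * (6 * y))" by (simp add: eval_nat_numeral)
      have "s\<^sup>2 = \<bar>s\<bar>\<^sup>2" by simp
      also have "\<dots> = (y ^ 3)\<^sup>2 * (2 * r\<^sup>2)" unfolding s by (simp add: power_mult_distrib)
      finally have 2: "2 * sqrt 2 / r * \<bar>s\<bar> + 1 / r\<^sup>2 * s\<^sup>2 = y ^ 3 * (4 + 2 * y ^ 3)"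
        unfolding s using r by (simp add: field_simps power2_eq_square)
      have "0 \<le> (y - 1)\<^sup>2 * (y + 2)" using y by simp
      then have "3 * y \<le> 2 + y ^ 3" by (simp add: power2_eq_square power3_eq_cube algebra_simps)
      then show ?thesis unfolding 1 2 using C y by (intro mult_left_mono) auto
    qed
    then have "rad_avg n (\<lambda>e. 3 * \<bar>rad_sum n a e\<bar> powr (4/3))
        \<le> rad_avg n (\<lambda>e. C * (2 * sqrt 2 / r * \<bar>rad_sum n a e\<bar> + 1 / r\<^sup>2 * (rad_sum n a e)\<^sup>2))"
      by (intro rad_avg_mono)
    also have "\<dots> = C * (2 * sqrt 2 / r * ?m + 1)"
      using False unfolding rad_avg_cmult rad_avg_add rad_avg_square r2[symmetric] by simp
    finally have "3 * rad_avg n (\<lambda>e. \<bar>rad_sum n a e\<bar> powr (4/3)) \<le> C * (2 * sqrt 2 / r * ?m + 1)"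
      unfolding rad_avg_cmult .
    moreover have "C \<le> rad_avg n (\<lambda>e. \<bar>rad_sum n a e\<bar> powr (4/3))"
      using khinchine_four_thirds[of a n] r powr_powr[of r 2 "2/3"]
      unfolding C_def r2[symmetric] by simp
    ultimately have "C * 3 \<le> C * (2 * sqrt 2 / r * ?m + 1)" by linarith
    then have "3 \<le> 2 * sqrt 2 / r * ?m + 1" using C by simp
    then show ?thesis using r by (simp add: field_simps)
  qed
  then show ?thesis by (simp add: r_def)
qed

text \<open>Minkowski's inequality for averages, needed to interchange the average over signs in one variable
  with a square function in another.\<close>

lemma L2_set_rad_avg_le:
  "L2_set (\<lambda>i. rad_avg n (F i)) A \<le> rad_avg n (\<lambda>e. L2_set (\<lambda>i. F i e) A)"
proof (induction n arbitrary: F)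
  case (Suc n)
  let ?P = "\<lambda>i. rad_avg n (\<lambda>e. F i (e(n := 1)))" and ?Q = "\<lambda>i. rad_avg n (\<lambda>e. F i (e(n := -1)))"
  have "L2_set (\<lambda>i. rad_avg (Suc n) (F i)) A = L2_set (\<lambda>i. ?P i + ?Q i) A * (1/2)"
    unfolding L2_set_left_distrib[OF order_less_imp_le[OF half_gt_zero[OF zero_less_one]]] by simp
  also have "\<dots> \<le> (L2_set ?P A + L2_set ?Q A) * (1/2)"
    by (intro mult_right_mono L2_set_triangle_ineq) simp
  also have "\<dots> \<le> (rad_avg n (\<lambda>e. L2_set (\<lambda>i. F i (e(n := 1))) A)
      + rad_avg n (\<lambda>e. L2_set (\<lambda>i. F i (e(n := -1))) A)) * (1/2)"
    by (intro mult_right_mono add_mono Suc.IH) simp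
  finally show ?case by simp
qed simp


section \<open>Mixed sequence norms: interpolation and interchange\<close>

definition lp_norm :: "real \<Rightarrow> nat \<Rightarrow> (nat \<Rightarrow> real) \<Rightarrow> real" where
  "lp_norm p N f = (\<Sum>j<N. f j powr p) powr (1 / p)"

lemma lp_norm_nonneg [simp]: "lp_norm p N f \<ge> 0"
  by (simp add: lp_norm_def)

lemma lp_norm_powr: "p > 0 \<Longrightarrow> lp_norm p N f powr p = (\<Sum>j<N. f j powr p)"
  by (simp add: lp_norm_def powr_powr sum_nonneg)

lemma lp_norm_mono:
  assumes "p > 0" "\<And>j. j < N \<Longrightarrow> 0 \<le> f j" "\<And>j. j < N \<Longrightarrow> f j \<le> g j"
  shows "lp_norm p N f \<le> lp_norm p N g"
  unfolding lp_norm_def using assms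
  by (intro powr_mono2 sum_mono sum_nonneg) auto

lemma lp_norm_1:
  assumes "\<And>j. j < N \<Longrightarrow> 0 \<le> f j"
  shows "lp_norm 1 N f = (\<Sum>j<N. f j)"
proof -
  have "(\<Sum>j<N. f j powr 1) = (\<Sum>j<N. f j)" using assms by (intro sum.cong) auto
  moreover have "0 \<le> (\<Sum>j<N. f j)" using assms by (intro sum_nonneg) auto
  ultimately show ?thesis by (simp add: lp_norm_def)
qed

lemma lp_norm_2:
  assumes "\<And>j. j < N \<Longrightarrow> 0 \<le> f j"
  shows "lp_norm 2 N f = L2_set f {..<N}"
proof -
  have "(\<Sum>j<N. f j powr 2) = (\<Sum>j<N. (f j)\<^sup>2)" using assms by (intro sum.cong) auto
  then show ?thesis by (simp add: lp_norm_def L2_set_def powr_half_sqrt sum_nonneg)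
qed

text \<open>Hoelder's inequality with the exponents \<open>1/s\<close> and \<open>1/(1 - s)\<close>, in the form in which it yields
  interpolation: a weighted geometric mean of sequences is summed at most by the geometric mean
  of the sums.\<close>

lemma holder_sum:
  fixes f g :: "'a \<Rightarrow> real"
  assumes fin: "finite I" and f: "\<And>i. i \<in> I \<Longrightarrow> 0 \<le> f i" and g: "\<And>i. i \<in> I \<Longrightarrow> 0 \<le> g i"
    and s: "0 < s" "s < 1"
  shows "(\<Sum>i\<in>I. f i powr s * g i powr (1 - s)) \<le> (\<Sum>i\<in>I. f i) powr s * (\<Sum>i\<in>I. g i) powr (1 - s)"
proof -
  define F G where "F = (\<Sum>i\<in>I. f i)" and "G = (\<Sum>i\<in>I. g i)"
  have "F \<ge> 0" "G \<ge> 0" unfolding F_def G_def using f g by (auto intro: sum_nonneg)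
  then consider "F = 0" | "G = 0" | "F > 0" "G > 0" by linarith
  then show ?thesis
  proof cases
    case 1
    then have "f i = 0" if "i \<in> I" for i
      using that sum_nonneg_eq_0_iff[OF fin f] unfolding F_def by simp
    then show ?thesis by simp
  next
    case 2
    then have "g i = 0" if "i \<in> I" for i
      using that sum_nonneg_eq_0_iff[OF fin g] unfolding G_def by simp
    then show ?thesis by simp
  next
    case 3
    have "f i powr s * g i powr (1 - s) \<le> F powr s * G powr (1 - s) * (s * (f i / F) + (1 - s) * (g i / G))"
      if "i \<in> I" for i
    proof -
      have "(f i / F) powr s * (g i / G) powr (1 - s) \<le> s * (f i / F) + (1 - s) * (g i / G)"
      proof (cases "f i = 0 \<or> g i = 0")
        case True
        then show ?thesis using that f g 3 s by auto
      next
        case False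
        then show ?thesis using f[OF that] g[OF that] 3 s by (intro Youngs_inequality_0) auto
      qed
      then have "F powr s * G powr (1 - s) * ((f i / F) powr s * (g i / G) powr (1 - s))
        \<le> F powr s * G powr (1 - s) * (s * (f i / F) + (1 - s) * (g i / G))"
        by (intro mult_left_mono) auto
      then show ?thesis
        using 3 that f g by (simp add: powr_divide)
    qed
    then have "(\<Sum>i\<in>I. f i powr s * g i powr (1 - s))
        \<le> (\<Sum>i\<in>I. F powr s * G powr (1 - s) * (s * (f i / F) + (1 - s) * (g i / G)))"
      by (rule sum_mono)
    also have "\<dots> = F powr s * G powr (1 - s) * (s * (F / F) + (1 - s) * (G / G))"
      by (simp only: sum_distrib_left[symmetric] sum.distrib sum_divide_distrib[symmetric]
          F_def[symmetric] G_def[symmetric])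
    finally show ?thesis using 3 unfolding F_def G_def by simp
  qed
qed

lemma lp_norm_interpolation:
  assumes f: "\<And>j. 0 \<le> f j" and g: "\<And>j. 0 \<le> g j" and h: "\<And>j. 0 \<le> h j"
    and hfg: "\<And>j. h j \<le> f j powr \<theta> * g j powr (1 - \<theta>)"
    and \<theta>: "0 < \<theta>" "\<theta> < 1" and p: "0 < p0" "0 < p1" and q: "1 / q = \<theta> / p0 + (1 - \<theta>) / p1"
  shows "lp_norm q N h \<le> lp_norm p0 N f powr \<theta> * lp_norm p1 N g powr (1 - \<theta>)"
proof -
  have "1 / q > 0" unfolding q using \<theta> p by (intro add_pos_pos divide_pos_pos) auto
  then have q0: "q > 0" by simp
  define s where "s = \<theta> * q / p0"
  have s1: "1 - s = (1 - \<theta>) * q / p1"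
  proof -
    have "q * (1 / q) = q * (\<theta> / p0 + (1 - \<theta>) / p1)" by (simp only: q)
    then show ?thesis using q0 by (simp add: s_def algebra_simps)
  qed
  have s: "0 < s" "s < 1"
  proof -
    show "0 < s" using \<theta> p q0 by (simp add: s_def)
    have "0 < 1 - s" unfolding s1 using \<theta> p q0 by simp
    then show "s < 1" by simp
  qed
  have "(\<Sum>j<N. h j powr q) \<le> (\<Sum>j<N. (f j powr p0) powr s * (g j powr p1) powr (1 - s))"
  proof (rule sum_mono)
    fix j
    have "h j powr q \<le> (f j powr \<theta> * g j powr (1 - \<theta>)) powr q"
      using h hfg q0 by (intro powr_mono2) auto
    also have "\<dots> = (f j powr p0) powr s * (g j powr p1) powr (1 - s)"
      using p unfolding s1 by (simp add: powr_mult powr_powr s_def)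
    finally show "h j powr q \<le> (f j powr p0) powr s * (g j powr p1) powr (1 - s)" .
  qed
  also have "\<dots> \<le> (\<Sum>j<N. f j powr p0) powr s * (\<Sum>j<N. g j powr p1) powr (1 - s)"
    using s by (intro holder_sum) auto
  finally have "lp_norm q N h
      \<le> ((\<Sum>j<N. f j powr p0) powr s * (\<Sum>j<N. g j powr p1) powr (1 - s)) powr (1 / q)"
    unfolding lp_norm_def using q0 by (intro powr_mono2 sum_nonneg) auto
  also have "\<dots> = lp_norm p0 N f powr \<theta> * lp_norm p1 N g powr (1 - \<theta>)"
    using q0 p unfolding s1 lp_norm_def by (simp add: powr_mult powr_powr s_def)
  finally show ?thesis .
qed

text \<open>The triangle inequality for \<open>r > 1\<close>. Write the \<open>r\<close>-th power of the sum \<open>U\<close> as \<open>U * U powr (r - 1)\<close>,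
  apply Hoelder's inequality to each summand of the first factor, and divide.\<close>

lemma minkowski_sum:
  assumes r: "r > 1" and u: "\<And>i s. 0 \<le> u i s"
  shows "lp_norm r N (\<lambda>i. \<Sum>s<K. u i s) \<le> (\<Sum>s<K. lp_norm r N (\<lambda>i. u i s))"
proof -
  define U where "U i = (\<Sum>s<K. u i s)" for i
  define S where "S = (\<Sum>i<N. U i powr r)"
  have U: "U i \<ge> 0" for i by (simp add: U_def sum_nonneg u)
  have S0: "S \<ge> 0" by (simp add: S_def sum_nonneg)
  have "S = (\<Sum>i<N. \<Sum>s<K. (u i s powr r) powr (1/r) * (U i powr r) powr (1 - 1/r))"
    unfolding S_def
  proof (rule sum.cong[OF refl])
    fix i
    have "U i powr r = U i * U i powr (r - 1)"
      using U[of i] by (cases "U i = 0") (simp_all add: powr_diff)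
    also have "U i powr (r - 1) = (U i powr r) powr (1 - 1/r)"
      using r by (simp add: powr_powr algebra_simps)
    also have "U i * (U i powr r) powr (1 - 1/r) = (\<Sum>s<K. u i s * (U i powr r) powr (1 - 1/r))"
      unfolding sum_distrib_right[symmetric] U_def ..
    also have "\<dots> = (\<Sum>s<K. (u i s powr r) powr (1/r) * (U i powr r) powr (1 - 1/r))"
    proof (rule sum.cong[OF refl])
      fix s
      have "(u i s powr r) powr (1/r) = u i s" using r u by (simp add: powr_powr)
      then show "u i s * (U i powr r) powr (1 - 1/r)
          = (u i s powr r) powr (1/r) * (U i powr r) powr (1 - 1/r)" by simp
    qed
    finally show "U i powr r = (\<Sum>s<K. (u i s powr r) powr (1/r) * (U i powr r) powr (1 - 1/r))" .
  qed
  also have "\<dots> = (\<Sum>s<K. \<Sum>i<N. (u i s powr r) powr (1/r) * (U i powr r) powr (1 - 1/r))"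
    by (rule sum.swap)
  also have "\<dots> \<le> (\<Sum>s<K. lp_norm r N (\<lambda>i. u i s) * S powr (1 - 1/r))"
    unfolding lp_norm_def S_def using r by (intro sum_mono holder_sum) auto
  also have "\<dots> = (\<Sum>s<K. lp_norm r N (\<lambda>i. u i s)) * S powr (1 - 1/r)"
    by (simp add: sum_distrib_right)
  finally have *: "S \<le> (\<Sum>s<K. lp_norm r N (\<lambda>i. u i s)) * S powr (1 - 1/r)" .
  have "S powr (1/r) \<le> (\<Sum>s<K. lp_norm r N (\<lambda>i. u i s))"
  proof (cases "S = 0")
    case False
    then have "S powr (1/r) * S powr (1 - 1/r) = S"
      using S0 unfolding powr_add[symmetric] by simp
    with * have "S powr (1/r) * S powr (1 - 1/r) \<le> (\<Sum>s<K. lp_norm r N (\<lambda>i. u i s)) * S powr (1 - 1/r)"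
      by simp
    then show ?thesis using False by simp
  qed (simp add: sum_nonneg)
  then show ?thesis unfolding lp_norm_def S_def U_def .
qed

text \<open>Minkowski's inequality for exponents: an iterated norm does not decrease when the norm with the
  smaller exponent is moved outside. It is the triangle inequality in the exponent \<open>r/p\<close> applied
  to the \<open>p\<close>-th powers.\<close>

lemma lp_norm_swap:
  assumes p: "0 < p" "p < r" and F: "\<And>i j. 0 \<le> F i j"
  shows "lp_norm r N (\<lambda>i. lp_norm p K (\<lambda>j. F i j)) \<le> lp_norm p K (\<lambda>j. lp_norm r N (\<lambda>i. F i j))"
proof -
  have "lp_norm r N (\<lambda>i. lp_norm p K (\<lambda>j. F i j))
      = lp_norm (r / p) N (\<lambda>i. \<Sum>j<K. F i j powr p) powr (1 / p)"
    using p by (simp add: lp_norm_def powr_powr)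
  also have "\<dots> \<le> (\<Sum>j<K. lp_norm (r / p) N (\<lambda>i. F i j powr p)) powr (1 / p)"
    using p by (intro powr_mono2 minkowski_sum) auto
  also have "\<dots> = lp_norm p K (\<lambda>j. lp_norm r N (\<lambda>i. F i j))"
    using p by (simp add: lp_norm_def powr_powr)
  finally show ?thesis .
qed

definition mixed_norm :: "real \<Rightarrow> real \<Rightarrow> real \<Rightarrow> nat \<Rightarrow> (nat \<Rightarrow> nat \<Rightarrow> nat \<Rightarrow> real) \<Rightarrow> real" where
  "mixed_norm q1 q2 q3 N F
    = lp_norm q1 N (\<lambda>i. lp_norm q2 N (\<lambda>j. lp_norm q3 N (\<lambda>k. \<bar>F i j k\<bar>)))"

text \<open>Hoelder's inequality at each of the three levels, starting from the innermost, where
  \<open>\<bar>F\<bar> = \<bar>F\<bar> powr \<theta> * \<bar>F\<bar> powr (1 - \<theta>)\<close>. The bounds are assumed positive because \<open>0 powr 0 = 0\<close>.\<close>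

lemma mixed_norm_interpolation:
  assumes \<theta>: "0 \<le> \<theta>" "\<theta> \<le> 1"
    and p: "0 < p1" "0 < p2" "0 < p3" and r: "0 < r1" "0 < r2" "0 < r3"
    and q: "1 / q1 = \<theta> / p1 + (1 - \<theta>) / r1" "1 / q2 = \<theta> / p2 + (1 - \<theta>) / r2"
      "1 / q3 = \<theta> / p3 + (1 - \<theta>) / r3"
    and A: "mixed_norm p1 p2 p3 N F \<le> A" and B: "mixed_norm r1 r2 r3 N F \<le> B"
    and pos: "0 < A" "0 < B"
  shows "mixed_norm q1 q2 q3 N F \<le> A powr \<theta> * B powr (1 - \<theta>)"
proof -
  consider "\<theta> = 0" | "\<theta> = 1" | "0 < \<theta>" "\<theta> < 1" using \<theta> by linarith
  then show ?thesis
  proof cases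
    case 1
    with q have "q1 = r1" "q2 = r2" "q3 = r3" by auto
    with 1 B pos show ?thesis by simp
  next
    case 2
    with q have "q1 = p1" "q2 = p2" "q3 = p3" by auto
    with 2 A pos show ?thesis by simp
  next
    case 3
    have "x = x powr \<theta> * x powr (1 - \<theta>)" if "x \<ge> 0" for x :: real
      using that unfolding powr_add[symmetric] by simp
    then have "mixed_norm q1 q2 q3 N F
        \<le> mixed_norm p1 p2 p3 N F powr \<theta> * mixed_norm r1 r2 r3 N F powr (1 - \<theta>)"
      unfolding mixed_norm_def using 3 p r q
      by (intro lp_norm_interpolation) auto
    also have "\<dots> \<le> A powr \<theta> * B powr (1 - \<theta>)"
      using 3 A B by (intro mult_mono powr_mono2) (auto simp: mixed_norm_def)
    finally show ?thesis .
  qed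
qed

section \<open>The three endpoint inequalities\<close>

text \<open>The norm of a bilinear form on vectors of \<open>N\<close> coordinates in the supremum norm is at most \<open>M\<close>; the
  absolute value may be omitted since \<open>\<epsilon>\<close> can be replaced by \<open>- \<epsilon>\<close>.\<close>

definition sign_bounded2 :: "nat \<Rightarrow> (nat \<Rightarrow> nat \<Rightarrow> real) \<Rightarrow> real \<Rightarrow> bool" where
  "sign_bounded2 N b M \<longleftrightarrow> (\<forall>\<epsilon> \<delta>. (\<forall>i<N. \<bar>\<epsilon> i\<bar> \<le> 1) \<longrightarrow> (\<forall>j<N. \<bar>\<delta> j\<bar> \<le> 1) \<longrightarrow>
    (\<Sum>i<N. \<Sum>j<N. b i j * \<epsilon> i * \<delta> j) \<le> M)"

definition sign_bounded3 :: "nat \<Rightarrow> (nat \<Rightarrow> nat \<Rightarrow> nat \<Rightarrow> real) \<Rightarrow> real \<Rightarrow> bool" where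
  "sign_bounded3 N t M \<longleftrightarrow> (\<forall>\<epsilon> \<delta> \<eta>. (\<forall>i<N. \<bar>\<epsilon> i\<bar> \<le> 1) \<longrightarrow> (\<forall>j<N. \<bar>\<delta> j\<bar> \<le> 1) \<longrightarrow>
    (\<forall>k<N. \<bar>\<eta> k\<bar> \<le> 1) \<longrightarrow> (\<Sum>i<N. \<Sum>j<N. \<Sum>k<N. t i j k * \<epsilon> i * \<delta> j * \<eta> k) \<le> M)"

lemma sign_bounded2_transpose:
  "sign_bounded2 N b M \<Longrightarrow> sign_bounded2 N (\<lambda>i j. b j i) M"
  unfolding sign_bounded2_def
proof (intro allI impI)
  fix \<epsilon> \<delta> :: "nat \<Rightarrow> real"
  assume b: "\<forall>\<epsilon> \<delta>. (\<forall>i<N. \<bar>\<epsilon> i\<bar> \<le> 1) \<longrightarrow> (\<forall>j<N. \<bar>\<delta> j\<bar> \<le> 1) \<longrightarrow>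
      (\<Sum>i<N. \<Sum>j<N. b i j * \<epsilon> i * \<delta> j) \<le> M"
    and *: "\<forall>i<N. \<bar>\<epsilon> i\<bar> \<le> 1" "\<forall>j<N. \<bar>\<delta> j\<bar> \<le> 1"
  have "(\<Sum>i<N. \<Sum>j<N. b j i * \<epsilon> i * \<delta> j) = (\<Sum>j<N. \<Sum>i<N. b j i * \<epsilon> i * \<delta> j)"
    by (rule sum.swap)
  also have "\<dots> = (\<Sum>j<N. \<Sum>i<N. b j i * \<delta> j * \<epsilon> i)"
    by (simp add: mult.commute mult.left_commute)
  also have "\<dots> \<le> M" using b * by blast
  finally show "(\<Sum>i<N. \<Sum>j<N. b j i * \<epsilon> i * \<delta> j) \<le> M" .
qed

lemma sign_bounded3_rotate:
  assumes "sign_bounded3 N t M"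
  shows "sign_bounded3 N (\<lambda>j k i. t i j k) M"
  unfolding sign_bounded3_def
proof (intro allI impI)
  fix \<delta> \<eta> \<epsilon> :: "nat \<Rightarrow> real"
  assume *: "\<forall>i<N. \<bar>\<delta> i\<bar> \<le> 1" "\<forall>i<N. \<bar>\<eta> i\<bar> \<le> 1" "\<forall>i<N. \<bar>\<epsilon> i\<bar> \<le> 1"
  have "(\<Sum>j<N. \<Sum>k<N. \<Sum>i<N. t i j k * \<delta> j * \<eta> k * \<epsilon> i)
      = (\<Sum>j<N. \<Sum>i<N. \<Sum>k<N. t i j k * \<delta> j * \<eta> k * \<epsilon> i)"
    by (intro sum.cong refl sum.swap)
  also have "\<dots> = (\<Sum>i<N. \<Sum>j<N. \<Sum>k<N. t i j k * \<delta> j * \<eta> k * \<epsilon> i)"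
    by (rule sum.swap)
  also have "\<dots> = (\<Sum>i<N. \<Sum>j<N. \<Sum>k<N. t i j k * \<epsilon> i * \<delta> j * \<eta> k)"
    by (simp add: mult.commute mult.left_commute)
  also have "\<dots> \<le> M" using assms * unfolding sign_bounded3_def by blast
  finally show "(\<Sum>j<N. \<Sum>k<N. \<Sum>i<N. t i j k * \<delta> j * \<eta> k * \<epsilon> i) \<le> M" .
qed

lemma sign_bounded3_slice:
  assumes t: "sign_bounded3 N t M" and e: "\<And>k. k < N \<Longrightarrow> \<bar>e k\<bar> \<le> 1"
  shows "sign_bounded2 N (\<lambda>i j. rad_sum N (t i j) e) M"
  unfolding sign_bounded2_def
proof (intro allI impI)
  fix \<epsilon> \<delta> :: "nat \<Rightarrow> real"
  assume *: "\<forall>i<N. \<bar>\<epsilon> i\<bar> \<le> 1" "\<forall>j<N. \<bar>\<delta> j\<bar> \<le> 1"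
  have "(\<Sum>i<N. \<Sum>j<N. rad_sum N (t i j) e * \<epsilon> i * \<delta> j)
      = (\<Sum>i<N. \<Sum>j<N. \<Sum>k<N. t i j k * \<epsilon> i * \<delta> j * e k)"
    unfolding sum_distrib_right by (intro sum.cong refl) (simp add: mult_ac)
  also have "\<dots> \<le> M"
    using t * e unfolding sign_bounded3_def by blast
  finally show "(\<Sum>i<N. \<Sum>j<N. rad_sum N (t i j) e * \<epsilon> i * \<delta> j) \<le> M" .
qed

text \<open>Choose \<open>\<epsilon> i\<close> to be the sign of the \<open>i\<close>-th row sum.\<close>

lemma sign_bounded2_row_sums:
  assumes b: "sign_bounded2 N b M" and \<delta>: "\<And>j. j < N \<Longrightarrow> \<bar>\<delta> j\<bar> \<le> 1"
  shows "(\<Sum>i<N. \<bar>\<Sum>j<N. b i j * \<delta> j\<bar>) \<le> M"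
proof -
  define \<epsilon> where "\<epsilon> i = sgn (\<Sum>j<N. b i j * \<delta> j)" for i
  have "(\<Sum>i<N. \<bar>\<Sum>j<N. b i j * \<delta> j\<bar>) = (\<Sum>i<N. \<epsilon> i * (\<Sum>j<N. b i j * \<delta> j))"
    by (simp add: \<epsilon>_def abs_sgn mult.commute)
  also have "\<dots> = (\<Sum>i<N. \<Sum>j<N. b i j * \<epsilon> i * \<delta> j)"
    by (simp add: sum_distrib_left mult.assoc mult.left_commute)
  also have "\<dots> \<le> M"
    using b \<delta> unfolding sign_bounded2_def by (auto simp: \<epsilon>_def sgn_if)
  finally show ?thesis .
qed

lemma rad_avg_le_const:
  assumes "\<And>e. (\<And>k. k < n \<Longrightarrow> e k \<in> {1, -1}) \<Longrightarrow> F e \<le> C"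
  shows "rad_avg n F \<le> C"
  using rad_avg_mono[of n F "\<lambda>_. C"] assms by simp

lemma sign_abs_le_1: "(\<And>k. k < n \<Longrightarrow> e k \<in> {1, -1 :: real}) \<Longrightarrow> j < n \<Longrightarrow> \<bar>e j\<bar> \<le> 1"
  by fastforce

text \<open>Khinchine's inequality in each row, after which the average over signs is controlled for every
  single choice of signs.\<close>

lemma mixed_littlewood:
  assumes b: "sign_bounded2 N b M"
  shows "(\<Sum>i<N. L2_set (\<lambda>j. b i j) {..<N}) \<le> sqrt 2 * M"
proof -
  have "(\<Sum>i<N. L2_set (\<lambda>j. b i j) {..<N})
      \<le> (\<Sum>i<N. sqrt 2 * rad_avg N (\<lambda>e. \<bar>rad_sum N (b i) e\<bar>))"
    by (intro sum_mono khinchine_one)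
  also have "\<dots> = sqrt 2 * rad_avg N (\<lambda>e. \<Sum>i<N. \<bar>rad_sum N (b i) e\<bar>)"
    by (simp add: rad_avg_sum sum_distrib_left)
  also have "\<dots> \<le> sqrt 2 * M"
    by (intro mult_left_mono rad_avg_le_const sign_bounded2_row_sums[OF b] sign_abs_le_1) auto
  finally show ?thesis .
qed


lemma L2_set_abs [simp]: "L2_set (\<lambda>j. \<bar>f j\<bar>) A = L2_set f A"
  by (simp add: L2_set_def)

text \<open>The exponents \<open>(4/3, 4/3)\<close> lie half way between \<open>(1, 2)\<close> and \<open>(2, 1)\<close> in the reciprocals. Both
  endpoints are bounded by \<open>sqrt 2 * M\<close>: the first is \<open>mixed_littlewood\<close>, and the second is reduced
  by \<open>lp_norm_swap\<close> to \<open>mixed_littlewood\<close> for the transposed matrix.\<close>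

lemma littlewood_four_thirds:
  assumes b: "sign_bounded2 N b M" and M: "0 \<le> M"
  shows "(\<Sum>i<N. \<Sum>j<N. \<bar>b i j\<bar> powr (4/3)) \<le> (sqrt 2 * M) powr (4/3)"
proof -
  define X where "X = lp_norm (4/3) N (\<lambda>i. lp_norm (4/3) N (\<lambda>j. \<bar>b i j\<bar>))"
  define P where "P = lp_norm 1 N (\<lambda>i. lp_norm 2 N (\<lambda>j. \<bar>b i j\<bar>))"
  define Q where "Q = lp_norm 2 N (\<lambda>i. lp_norm 1 N (\<lambda>j. \<bar>b i j\<bar>))"
  have P: "P \<le> sqrt 2 * M"
    using mixed_littlewood[OF b] unfolding P_def by (simp add: lp_norm_1 lp_norm_2)
  have "Q \<le> lp_norm 1 N (\<lambda>j. lp_norm 2 N (\<lambda>i. \<bar>b i j\<bar>))"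
    unfolding Q_def by (intro lp_norm_swap) auto
  also have "\<dots> \<le> sqrt 2 * M"
    using mixed_littlewood[OF sign_bounded2_transpose[OF b]] by (simp add: lp_norm_1 lp_norm_2)
  finally have Q: "Q \<le> sqrt 2 * M" .
  have split: "x = x powr (1/2) * x powr (1 - 1/2)" if "x \<ge> 0" for x :: real
    using that unfolding powr_add[symmetric] by simp
  have "X \<le> P powr (1/2) * Q powr (1 - 1/2)"
    unfolding X_def P_def Q_def
  proof (rule lp_norm_interpolation)
    fix i
    show "lp_norm (4/3) N (\<lambda>j. \<bar>b i j\<bar>)
        \<le> lp_norm 2 N (\<lambda>j. \<bar>b i j\<bar>) powr (1/2) * lp_norm 1 N (\<lambda>j. \<bar>b i j\<bar>) powr (1 - 1/2)"
    proof (rule lp_norm_interpolation)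
      fix j
      show "\<bar>b i j\<bar> \<le> \<bar>b i j\<bar> powr (1/2) * \<bar>b i j\<bar> powr (1 - 1/2)"
        by (rule eq_refl[OF split]) simp
    qed auto
  qed auto
  also have "\<dots> \<le> (sqrt 2 * M) powr (1/2) * (sqrt 2 * M) powr (1 - 1/2)"
    using P Q by (intro mult_mono powr_mono2) (auto simp: P_def Q_def)
  also have "\<dots> = sqrt 2 * M" using split[of "sqrt 2 * M"] M by simp
  finally have "X powr (4/3) \<le> (sqrt 2 * M) powr (4/3)"
    by (intro powr_mono2) (auto simp: X_def)
  then show ?thesis unfolding X_def by (simp add: lp_norm_powr)
qed

text \<open>Replace the inner square function by the average over signs in the third variable, and apply
  Littlewood's inequality to the bilinear form obtained for each choice of signs.\<close>

lemma mixed_norm_four_thirds_four_thirds_two: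
  assumes t: "sign_bounded3 N t M" and M: "0 \<le> M"
  shows "mixed_norm (4/3) (4/3) 2 N t \<le> 2 powr (3/4) * M"
proof -
  define L where "L i j = L2_set (t i j) {..<N}" for i j
  have "L i j powr (4/3) \<le> 1 / khinchine_const * rad_avg N (\<lambda>e. \<bar>rad_sum N (t i j) e\<bar> powr (4/3))" for i j
  proof -
    have "L i j powr (4/3) = (\<Sum>k<N. (t i j k)\<^sup>2) powr (2/3)"
      by (simp add: L_def L2_set_def sum_nonneg powr_powr flip: powr_half_sqrt)
    then show ?thesis
      using khinchine_four_thirds[of "t i j" N] khinchine_const_pos by (simp add: field_simps)
  qed
  then have "(\<Sum>i<N. \<Sum>j<N. L i j powr (4/3))
      \<le> (\<Sum>i<N. \<Sum>j<N. 1 / khinchine_const * rad_avg N (\<lambda>e. \<bar>rad_sum N (t i j) e\<bar> powr (4/3)))"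
    by (intro sum_mono)
  also have "\<dots> = 1 / khinchine_const * rad_avg N (\<lambda>e. \<Sum>i<N. \<Sum>j<N. \<bar>rad_sum N (t i j) e\<bar> powr (4/3))"
    by (simp add: rad_avg_sum sum_distrib_left)
  also have "\<dots> \<le> 1 / khinchine_const * (sqrt 2 * M) powr (4/3)"
  proof (intro mult_left_mono rad_avg_le_const littlewood_four_thirds M)
    fix e :: "nat \<Rightarrow> real" assume e: "\<And>k. k < N \<Longrightarrow> e k \<in> {1, -1}"
    show "sign_bounded2 N (\<lambda>i j. rad_sum N (t i j) e) M"
      using t sign_abs_le_1[OF e] by (rule sign_bounded3_slice)
  qed (use khinchine_const_pos in auto)
  finally have "(\<Sum>i<N. \<Sum>j<N. L i j powr (4/3)) powr (3/4) \<le> (1 / khinchine_const * (sqrt 2 * M) powr (4/3)) powr (3/4)"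
    by (intro powr_mono2 sum_nonneg) auto
  also have "\<dots> = (1 / khinchine_const) powr (3/4) * (sqrt 2 * M)"
    using M khinchine_const_pos by (subst powr_mult) (auto simp: powr_powr)
  also have "(1 / khinchine_const) powr (3/4) = 2 powr (1/4)"
    by (simp add: khinchine_const_def powr_powr flip: powr_minus_divide)
  also have "2 powr (1/4) * (sqrt 2 * M) = 2 powr (3/4) * M"
  proof -
    have "2 powr (1/4) * sqrt 2 = (2 powr (3/4) :: real)"
      unfolding powr_half_sqrt[of 2, symmetric, simplified] powr_add[symmetric] by simp
    then show ?thesis by (simp flip: mult.assoc)
  qed
  finally show ?thesis
    unfolding mixed_norm_def lp_norm_2[OF abs_ge_zero] L2_set_abs L_def[symmetric]
    by (simp add: lp_norm_def[of "4/3" N "\<lambda>i. lp_norm (4/3) N (L i)"] lp_norm_powr)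
qed

text \<open>Two interchanges move the exponent 2 from the first variable inside past the other two.\<close>

lemma mixed_norm_two_four_thirds_four_thirds:
  assumes t: "sign_bounded3 N t M" and M: "0 \<le> M"
  shows "mixed_norm 2 (4/3) (4/3) N t \<le> 2 powr (3/4) * M"
proof -
  have "mixed_norm 2 (4/3) (4/3) N t
      \<le> lp_norm (4/3) N (\<lambda>j. lp_norm 2 N (\<lambda>i. lp_norm (4/3) N (\<lambda>k. \<bar>t i j k\<bar>)))"
    unfolding mixed_norm_def by (intro lp_norm_swap) auto
  also have "\<dots> \<le> lp_norm (4/3) N (\<lambda>j. lp_norm (4/3) N (\<lambda>k. lp_norm 2 N (\<lambda>i. \<bar>t i j k\<bar>)))"
    by (intro lp_norm_mono lp_norm_swap) auto
  also have "\<dots> = mixed_norm (4/3) (4/3) 2 N (\<lambda>j k i. t i j k)" by (simp add: mixed_norm_def)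
  also have "\<dots> \<le> 2 powr (3/4) * M"
    by (rule mixed_norm_four_thirds_four_thirds_two[OF sign_bounded3_rotate[OF t] M])
  finally show ?thesis .
qed

text \<open>Once the exponent 1 is moved outside, each summand is a Hilbert-Schmidt norm. Khinchine's inequality
  in the third and in the first variable bounds it by twice an average of absolute values, whose sum
  over \<open>j\<close> is at most \<open>M\<close> for every choice of signs.\<close>

lemma mixed_norm_two_one_two:
  assumes t: "sign_bounded3 N t M"
  shows "mixed_norm 2 1 2 N t \<le> 2 * M"
proof -
  have "mixed_norm 2 1 2 N t \<le> lp_norm 1 N (\<lambda>j. lp_norm 2 N (\<lambda>i. lp_norm 2 N (\<lambda>k. \<bar>t i j k\<bar>)))"
    unfolding mixed_norm_def by (intro lp_norm_swap) auto
  also have "\<dots> = (\<Sum>j<N. L2_set (\<lambda>i. L2_set (t i j) {..<N}) {..<N})"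
    by (simp add: lp_norm_1 lp_norm_2)
  also have "\<dots> \<le> (\<Sum>j<N. 2 * rad_avg N (\<lambda>e. rad_avg N (\<lambda>e'. \<bar>\<Sum>i<N. rad_sum N (t i j) e * e' i\<bar>)))"
  proof (rule sum_mono)
    fix j
    have "L2_set (\<lambda>i. L2_set (t i j) {..<N}) {..<N}
        \<le> L2_set (\<lambda>i. sqrt 2 * rad_avg N (\<lambda>e. \<bar>rad_sum N (t i j) e\<bar>)) {..<N}"
      by (intro L2_set_mono khinchine_one) auto
    also have "\<dots> = sqrt 2 * L2_set (\<lambda>i. rad_avg N (\<lambda>e. \<bar>rad_sum N (t i j) e\<bar>)) {..<N}"
      by (simp add: L2_set_right_distrib)
    also have "\<dots> \<le> sqrt 2 * rad_avg N (\<lambda>e. L2_set (\<lambda>i. \<bar>rad_sum N (t i j) e\<bar>) {..<N})"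
      by (intro mult_left_mono L2_set_rad_avg_le) auto
    also have "\<dots> \<le> sqrt 2 * rad_avg N (\<lambda>e. sqrt 2 * rad_avg N (\<lambda>e'. \<bar>\<Sum>i<N. rad_sum N (t i j) e * e' i\<bar>))"
      unfolding L2_set_abs by (intro mult_left_mono rad_avg_mono khinchine_one) auto
    finally show "L2_set (\<lambda>i. L2_set (t i j) {..<N}) {..<N}
        \<le> 2 * rad_avg N (\<lambda>e. rad_avg N (\<lambda>e'. \<bar>\<Sum>i<N. rad_sum N (t i j) e * e' i\<bar>))"
      unfolding rad_avg_cmult by (simp flip: mult.assoc)
  qed
  also have "\<dots> = 2 * rad_avg N (\<lambda>e. rad_avg N (\<lambda>e'. \<Sum>j<N. \<bar>\<Sum>i<N. rad_sum N (t i j) e * e' i\<bar>))"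
    by (simp add: rad_avg_sum sum_distrib_left)
  also have "\<dots> \<le> 2 * M"
  proof (intro mult_left_mono rad_avg_le_const)
    fix e e' :: "nat \<Rightarrow> real"
    assume e: "\<And>k. k < N \<Longrightarrow> e k \<in> {1, -1}" and e': "\<And>k. k < N \<Longrightarrow> e' k \<in> {1, -1}"
    have "sign_bounded2 N (\<lambda>i j. rad_sum N (t i j) e) M"
      using t sign_abs_le_1[OF e] by (rule sign_bounded3_slice)
    from sign_bounded2_row_sums[OF sign_bounded2_transpose[OF this] sign_abs_le_1[OF e']]
    show "(\<Sum>j<N. \<bar>\<Sum>i<N. rad_sum N (t i j) e * e' i\<bar>) \<le> M" .
  qed simp
  finally show ?thesis .
qed

section \<open>Trilinear forms on the space of null sequences\<close>

lemma coord_sum: "coord (\<Sum>i\<in>I. f i) n = (\<Sum>i\<in>I. coord (f i) n)"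
  by (induction I rule: infinite_finite_induct) simp_all

lemma norm_sum_unit_vec_le_1:
  assumes "\<And>i. i < N \<Longrightarrow> \<bar>\<epsilon> i\<bar> \<le> 1"
  shows "norm (\<Sum>i<N. \<epsilon> i *\<^sub>R unit_vec i) \<le> 1"
proof (rule norm_c0_le)
  fix n
  have "coord (\<Sum>i<N. \<epsilon> i *\<^sub>R unit_vec i) n = (\<Sum>i<N. if n = i then \<epsilon> i else 0)"
    unfolding coord_sum by (intro sum.cong) (auto simp: unit_vec.rep_eq)
  also have "\<dots> = (if n < N then \<epsilon> n else 0)" by simp
  finally show "\<bar>coord (\<Sum>i<N. \<epsilon> i *\<^sub>R unit_vec i) n\<bar> \<le> 1" using assms by auto
qed

lemma norm_unit_vec_le_1: "norm (unit_vec i) \<le> 1"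
  by (rule norm_c0_le) (simp add: unit_vec.rep_eq)

lemma trilinear_scale:
  assumes "trilinear T"
  shows "T (a *\<^sub>R x) (b *\<^sub>R y) (c *\<^sub>R z) = a * b * c * T x y z"
proof -
  have "T (a *\<^sub>R x) y z = a * T x y z" "T x (a *\<^sub>R y) z = a * T x y z" "T x y (a *\<^sub>R z) = a * T x y z"
    for a x y z
    using assms unfolding trilinear_def by (metis linear_cmul real_scaleR_def)+
  then show ?thesis by simp
qed

lemma trilinear_sum:
  assumes "trilinear T"
  shows "T (\<Sum>i\<in>I. f i) (\<Sum>j\<in>J. g j) (\<Sum>k\<in>K. h k) = (\<Sum>i\<in>I. \<Sum>j\<in>J. \<Sum>k\<in>K. T (f i) (g j) (h k))"
proof -
  have 1: "T (\<Sum>i\<in>I. f i) y z = (\<Sum>i\<in>I. T (f i) y z)" for y z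
    using assms linear_sum[of "\<lambda>x. T x y z" f I] unfolding trilinear_def by auto
  have 2: "T x (\<Sum>j\<in>J. g j) z = (\<Sum>j\<in>J. T x (g j) z)" for x z
    using assms linear_sum[of "\<lambda>y. T x y z" g J] unfolding trilinear_def by auto
  have 3: "T x y (\<Sum>k\<in>K. h k) = (\<Sum>k\<in>K. T x y (h k))" for x y
    using assms linear_sum[of "\<lambda>z. T x y z" h K] unfolding trilinear_def by auto
  show ?thesis unfolding 1 unfolding 2 unfolding 3 ..
qed

text \<open>Continuity at the origin bounds the form on a small ball, and homogeneity of degree 3 carries the
  bound to the unit ball. Without this the supremum that defines \<open>form_norm\<close> would say nothing.\<close>

lemma continuous_trilinear_bounded:
  assumes T: "continuous_trilinear T"
  shows "bdd_above {\<bar>T x y z\<bar> | x y z. norm x \<le> 1 \<and> norm y \<le> 1 \<and> norm z \<le> 1}"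
proof -
  have tri: "trilinear T" and cont: "continuous_on UNIV (\<lambda>(x, y, z). T x y z)"
    using T by (auto simp: continuous_trilinear_def)
  have T0: "T 0 0 0 = 0" using trilinear_scale[OF tri, of 0 0 0 0 0 0] by simp
  obtain d where d: "d > 0"
    and less: "\<And>p. dist p (0, 0, 0) < d \<Longrightarrow> dist ((\<lambda>(x, y, z). T x y z) p) ((\<lambda>(x, y, z). T x y z) (0, 0, 0)) < 1"
    using cont unfolding continuous_on_iff by (metis UNIV_I zero_less_one)
  \<comment> \<open>any factor below \<open>d / 3\<close> serves: three vectors of norm at most \<open>s\<close> have joint norm below \<open>d\<close>\<close>
  define s where "s = d / 4"
  have s: "s > 0" using d by (simp add: s_def)
  have "\<bar>T x y z\<bar> \<le> 1 / s ^ 3" if n: "norm x \<le> 1" "norm y \<le> 1" "norm z \<le> 1" for x y z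
  proof -
    have "norm (s *\<^sub>R x, s *\<^sub>R y, s *\<^sub>R z) \<le> norm (s *\<^sub>R x) + (norm (s *\<^sub>R y) + norm (s *\<^sub>R z))"
      by (meson add_left_mono norm_Pair_le order_trans)
    also have "\<dots> \<le> s + (s + s)" using s n by (intro add_mono) (auto intro: mult_left_le)
    also have "\<dots> < d" using d by (simp add: s_def)
    finally have "dist (s *\<^sub>R x, s *\<^sub>R y, s *\<^sub>R z) (0, 0, 0) < d"
      by (simp add: dist_norm zero_prod_def[symmetric])
    from less[OF this] have "\<bar>s * s * s * T x y z\<bar> < 1"
      by (simp add: T0 trilinear_scale[OF tri])
    then show ?thesis using s by (simp add: abs_mult field_simps power3_eq_cube)
  qed
  then show ?thesis by (intro bdd_aboveI[of _ "1 / s ^ 3"]) auto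
qed

lemma abs_le_form_norm:
  assumes "continuous_trilinear T" "norm x \<le> 1" "norm y \<le> 1" "norm z \<le> 1"
  shows "\<bar>T x y z\<bar> \<le> form_norm T"
  unfolding form_norm_def
  by (rule cSup_upper[OF _ continuous_trilinear_bounded[OF assms(1)]]) (use assms in blast)

lemma form_norm_nonneg: "continuous_trilinear T \<Longrightarrow> 0 \<le> form_norm T"
  using abs_le_form_norm[of T 0 0 0] by simp

lemma sign_bounded3_form:
  assumes T: "continuous_trilinear T"
  shows "sign_bounded3 N (\<lambda>i j k. T (unit_vec i) (unit_vec j) (unit_vec k)) (form_norm T)"
  unfolding sign_bounded3_def
proof (intro allI impI)
  fix \<epsilon> \<delta> \<eta> :: "nat \<Rightarrow> real"
  assume *: "\<forall>i<N. \<bar>\<epsilon> i\<bar> \<le> 1" "\<forall>j<N. \<bar>\<delta> j\<bar> \<le> 1" "\<forall>k<N. \<bar>\<eta> k\<bar> \<le> 1"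
  have tri: "trilinear T" using T by (simp add: continuous_trilinear_def)
  let ?S = "\<lambda>\<epsilon>. \<Sum>i<N. \<epsilon> i *\<^sub>R unit_vec i"
  have "(\<Sum>i<N. \<Sum>j<N. \<Sum>k<N. T (unit_vec i) (unit_vec j) (unit_vec k) * \<epsilon> i * \<delta> j * \<eta> k)
      = T (?S \<epsilon>) (?S \<delta>) (?S \<eta>)"
    unfolding trilinear_sum[OF tri] trilinear_scale[OF tri]
    by (intro sum.cong refl) (simp add: mult_ac)
  also have "\<dots> \<le> \<bar>T (?S \<epsilon>) (?S \<delta>) (?S \<eta>)\<bar>" by simp
  also have "\<dots> \<le> form_norm T"
    using * by (intro abs_le_form_norm[OF T] norm_sum_unit_vec_le_1) auto
  finally show "(\<Sum>i<N. \<Sum>j<N. \<Sum>k<N. T (unit_vec i) (unit_vec j) (unit_vec k) * \<epsilon> i * \<delta> j * \<eta> k)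
      \<le> form_norm T" .
qed

lemma mixed_sum_eq_mixed_norm:
  assumes "0 < q1" "0 < q2" "0 < q3"
  shows "mixed_sum (q1, q2, q3) N T
    = mixed_norm q1 q2 q3 N (\<lambda>i j k. T (unit_vec i) (unit_vec j) (unit_vec k))"
  using assms by (simp add: mixed_sum_def mixed_norm_def lp_norm_def powr_powr)

text \<open>Interpolate first between the two endpoints with constant \<open>2 powr (3/4)\<close>, with weight \<open>\<tau>\<close>, and then
  with \<open>(2, 1, 2)\<close>, with weight \<open>\<theta>\<close>; the constant becomes \<open>2 powr (\<theta> + 3/4 * (1 - \<theta>))\<close>.\<close>

lemma BH_bound_interpolated:
  fixes \<tau> \<theta> :: real
  assumes \<tau>: "0 \<le> \<tau>" "\<tau> \<le> 1" and \<theta>: "0 \<le> \<theta>" "\<theta> \<le> 1"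
    and q: "1 / q1 = (2 + \<tau> - \<theta> * \<tau>) / 4" "1 / q2 = (\<theta> + 3) / 4"
      "1 / q3 = (3 + \<theta> * \<tau> - \<theta> - \<tau>) / 4"
    and pos: "0 < q1" "0 < q2" "0 < q3"
  shows "BH_bound (q1, q2, q3) (2 powr ((\<theta> + 3) / 4))"
  unfolding BH_bound_def
proof (intro allI impI)
  fix T :: "c0 \<Rightarrow> c0 \<Rightarrow> c0 \<Rightarrow> real" and N :: nat
  assume T: "continuous_trilinear T"
  define t where "t i j k = T (unit_vec i) (unit_vec j) (unit_vec k)" for i j k
  define M where "M = form_norm T"
  have M0: "0 \<le> M" using form_norm_nonneg[OF T] by (simp add: M_def)
  have t: "sign_bounded3 N t M" using sign_bounded3_form[OF T] by (simp add: t_def[abs_def] M_def)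
  have "mixed_norm q1 q2 q3 N t \<le> 2 powr ((\<theta> + 3) / 4) * M"
  proof (cases "M = 0")
    case True
    have "\<bar>t i j k\<bar> \<le> 0" for i j k
      using abs_le_form_norm[OF T norm_unit_vec_le_1 norm_unit_vec_le_1 norm_unit_vec_le_1] True
      by (simp add: t_def M_def)
    then have "t i j k = 0" for i j k by simp
    then show ?thesis using True by (simp add: mixed_norm_def lp_norm_def)
  next
    case False
    with M0 have M: "0 < M" by simp
    \<comment> \<open>the exponents reached by interpolation between the last two endpoints, i.e. for \<open>\<theta> = 0\<close>\<close>
    define r1 r3 where "r1 = 4 / (2 + \<tau>)" and "r3 = 4 / (3 - \<tau>)"
    have r: "0 < r1" "0 < r3" using \<tau> by (simp_all add: r1_def r3_def)
    have "mixed_norm r1 (4/3) r3 N t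
        \<le> (2 powr (3/4) * M) powr \<tau> * (2 powr (3/4) * M) powr (1 - \<tau>)"
      by (rule mixed_norm_interpolation[OF \<tau> _ _ _ _ _ _ _ _ _
            mixed_norm_four_thirds_four_thirds_two[OF t M0] mixed_norm_two_four_thirds_four_thirds[OF t M0]])
        (use M in \<open>auto simp: r1_def r3_def field_simps\<close>)
    also have "\<dots> = 2 powr (3/4) * M"
      using M unfolding powr_add[symmetric] by simp
    finally have 1: "mixed_norm r1 (4/3) r3 N t \<le> 2 powr (3/4) * M" .
    have "mixed_norm q1 q2 q3 N t \<le> (2 * M) powr \<theta> * (2 powr (3/4) * M) powr (1 - \<theta>)"
      by (rule mixed_norm_interpolation[OF \<theta> _ _ _ _ _ _ _ _ _ mixed_norm_two_one_two[OF t] 1])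
        (use M r in \<open>auto simp: q r1_def r3_def field_simps\<close>)
    also have "\<dots> = 2 powr ((\<theta> + 3) / 4) * M"
    proof -
      have "2 powr \<theta> * 2 powr (3/4 * (1 - \<theta>)) = (2 powr ((\<theta> + 3) / 4) :: real)"
        unfolding powr_add[symmetric] by (simp add: field_simps)
      moreover have "M powr \<theta> * M powr (1 - \<theta>) = M"
        using M unfolding powr_add[symmetric] by simp
      moreover have "(2 * M) powr \<theta> * (2 powr (3/4) * M) powr (1 - \<theta>)
          = (2 powr \<theta> * 2 powr (3/4 * (1 - \<theta>))) * (M powr \<theta> * M powr (1 - \<theta>))"
        using M by (simp add: powr_mult powr_powr)
      ultimately show ?thesis by simp
    qed
    finally show ?thesis .
  qed
  then show "mixed_sum (q1, q2, q3) N T \<le> 2 powr ((\<theta> + 3) / 4) * form_norm T"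
    unfolding mixed_sum_eq_mixed_norm[OF pos] t_def[abs_def] M_def .
qed


section \<open>The extremal form and the optimal constant\<close>

text \<open>Two copies of Littlewood's bilinear form on disjoint coordinates of \<open>y\<close> and \<open>z\<close>, switched by
  the first variable. The two-valued index has to be the first one and the
  four-valued index the second one: the mixed sum is then governed by \<open>1/q2\<close>.\<close>

definition extremal_form :: "c0 \<Rightarrow> c0 \<Rightarrow> c0 \<Rightarrow> real" where
  "extremal_form x y z =
     (coord x 0 + coord x 1)
       * (coord y 0 * (coord z 0 + coord z 1) + coord y 1 * (coord z 0 - coord z 1))
   + (coord x 0 - coord x 1)
       * (coord y 2 * (coord z 2 + coord z 3) + coord y 3 * (coord z 2 - coord z 3))"

lemma bounded_linear_coord: "bounded_linear (\<lambda>x. coord x n)"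
  by (rule bounded_linear_intro[of _ 1]) (simp_all add: abs_coord_le_norm)

lemma continuous_trilinear_extremal_form: "continuous_trilinear extremal_form"
proof -
  have "trilinear extremal_form"
    unfolding trilinear_def extremal_form_def
    by (intro conjI allI linearI) (simp_all add: algebra_simps)
  moreover have "continuous_on UNIV (\<lambda>p. extremal_form (fst p) (fst (snd p)) (snd (snd p)))"
    unfolding extremal_form_def
    by (intro continuous_intros bounded_linear.continuous_on[OF bounded_linear_coord])
  ultimately show ?thesis
    by (simp add: continuous_trilinear_def case_prod_beta)
qed

lemma form_norm_extremal_form: "form_norm extremal_form \<le> 4"
  unfolding form_norm_def
proof (rule cSup_least)
  have "\<bar>extremal_form 0 0 0\<bar> \<in> {\<bar>extremal_form x y z\<bar> | x y z. norm x \<le> 1 \<and> norm y \<le> 1 \<and> norm z \<le> 1}"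
    by (rule CollectI, rule exI[of _ 0], rule exI[of _ 0], rule exI[of _ 0]) simp
  then show "{\<bar>extremal_form x y z\<bar> | x y z. norm x \<le> 1 \<and> norm y \<le> 1 \<and> norm z \<le> 1} \<noteq> {}"
    by blast
  have two: "\<bar>a * (u + v) + b * (u - v)\<bar> \<le> 2"
    if "\<bar>a\<bar> \<le> 1" "\<bar>b\<bar> \<le> 1" "\<bar>u\<bar> \<le> 1" "\<bar>v\<bar> \<le> 1" for a b u v :: real
  proof -
    have "\<bar>a * (u + v) + b * (u - v)\<bar> \<le> \<bar>a\<bar> * \<bar>u + v\<bar> + \<bar>b\<bar> * \<bar>u - v\<bar>"
      using abs_triangle_ineq[of "a * (u + v)" "b * (u - v)"] by (simp add: abs_mult)
    also have "\<dots> \<le> 1 * \<bar>u + v\<bar> + 1 * \<bar>u - v\<bar>"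
      using that by (intro add_mono mult_right_mono) auto
    also have "\<dots> \<le> 2" using that(3,4) by (auto simp: abs_if split: if_splits)
    finally show ?thesis .
  qed
  fix r assume "r \<in> {\<bar>extremal_form x y z\<bar> | x y z. norm x \<le> 1 \<and> norm y \<le> 1 \<and> norm z \<le> 1}"
  then obtain x y z where r: "r = \<bar>extremal_form x y z\<bar>"
    and n: "norm x \<le> 1" "norm y \<le> 1" "norm z \<le> 1" by blast
  have le: "\<bar>coord x i\<bar> \<le> 1" "\<bar>coord y i\<bar> \<le> 1" "\<bar>coord z i\<bar> \<le> 1" for i
    using n abs_coord_le_norm order_trans by blast+
  define B where "B i j = coord y i * (coord z i + coord z j) + coord y j * (coord z i - coord z j)" for i j
  have B: "\<bar>B i j\<bar> \<le> 2" for i j unfolding B_def by (intro two le)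
  have "extremal_form x y z = 2 * (B 0 1 / 2 * (coord x 0 + coord x 1) + B 2 3 / 2 * (coord x 0 - coord x 1))"
    by (simp add: extremal_form_def B_def)
  moreover have "\<bar>B 0 1 / 2 * (coord x 0 + coord x 1) + B 2 3 / 2 * (coord x 0 - coord x 1)\<bar> \<le> 2"
    using B by (intro two le) (auto simp: abs_divide)
  ultimately show "r \<le> 4" unfolding r by simp
qed

lemma mixed_sum_extremal_form:
  assumes pos: "0 < q1" "0 < q2" "0 < q3"
  shows "mixed_sum (q1, q2, q3) 4 extremal_form = 2 powr (1 / q1 + 2 / q2 + 1 / q3)"
proof -
  have set: "{..<4::nat} = {0, 1, 2, 3}" by auto
  have inner: "(\<Sum>k<4. \<bar>extremal_form (unit_vec i) (unit_vec j) (unit_vec k)\<bar> powr q3)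
      = (if i < 2 then 2 else 0)" if "i < 4" "j < 4" for i j
  proof -
    have "i \<in> {0, 1, 2, 3}" "j \<in> {0, 1, 2, 3}" using that by auto
    then show ?thesis
      unfolding set extremal_form_def
      by (elim insertE emptyE) (simp_all add: unit_vec.rep_eq)
  qed
  have "mixed_sum (q1, q2, q3) 4 extremal_form
      = (\<Sum>i<4. (\<Sum>j<4::nat. (if i < (2::nat) then 2 else 0) powr (q2 / q3)) powr (q1 / q2)) powr (1 / q1)"
    unfolding mixed_sum_def prod.case
    by (intro arg_cong2[where f = "(powr)"] sum.cong refl inner) auto
  also have "\<dots> = (2 * (4 * 2 powr (q2 / q3)) powr (q1 / q2)) powr (1 / q1)"
    unfolding set by simp
  also have "\<dots> = 2 powr (1 / q1) * (4 powr (1 / q2) * 2 powr (1 / q3))"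
    using pos by (simp add: powr_mult powr_powr)
  also have "4 powr (1 / q2) = (2 powr 2) powr (1 / q2)" by simp
  also have "\<dots> = 2 powr (2 / q2)" unfolding powr_powr by simp
  finally show ?thesis by (simp add: powr_add)
qed

theorem proposition5p2:
  fixes \<tau> \<theta> :: real
  assumes "\<tau> \<in> {0..1}" and "\<theta> \<in> {0..1}"
  shows "optimal_BH_constant
           (4 / (2 + \<tau> - \<theta> * \<tau>), 4 / (\<theta> + 3), 4 / (3 + \<theta> * \<tau> - \<theta> - \<tau>))
           (2 powr ((\<theta> + 3) / 4))"
proof -
  have \<tau>: "0 \<le> \<tau>" "\<tau> \<le> 1" and \<theta>: "0 \<le> \<theta>" "\<theta> \<le> 1" using assms by auto
  define q1 q2 q3 where "q1 = 4 / (2 + \<tau> - \<theta> * \<tau>)" and "q2 = 4 / (\<theta> + 3)"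
    and "q3 = 4 / (3 + \<theta> * \<tau> - \<theta> - \<tau>)"
  have "\<theta> * \<tau> \<le> \<tau>" using \<tau> \<theta> by (simp add: mult_left_le_one_le)
  moreover have "0 \<le> \<theta> * \<tau>" using \<tau> \<theta> by simp
  ultimately have "0 < 2 + \<tau> - \<theta> * \<tau>" "0 < \<theta> + 3" "0 < 3 + \<theta> * \<tau> - \<theta> - \<tau>"
    using \<tau> \<theta> by linarith+
  then have pos: "0 < q1" "0 < q2" "0 < q3"
    unfolding q1_def q2_def q3_def by simp_all
  have q: "1 / q1 = (2 + \<tau> - \<theta> * \<tau>) / 4" "1 / q2 = (\<theta> + 3) / 4"
    "1 / q3 = (3 + \<theta> * \<tau> - \<theta> - \<tau>) / 4"
    by (simp_all add: q1_def q2_def q3_def)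
  have "2 powr ((\<theta> + 3) / 4) \<le> C" if C: "BH_bound (q1, q2, q3) C" for C
  proof -
    have "1 / q1 + 2 / q2 + 1 / q3 = 2 + (\<theta> + 3) / 4"
      using q(2) q(1,3) by (simp add: field_simps)
    then have "4 * 2 powr ((\<theta> + 3) / 4) = mixed_sum (q1, q2, q3) 4 extremal_form"
      unfolding mixed_sum_extremal_form[OF pos] by (simp add: powr_add)
    also have "\<dots> \<le> C * form_norm extremal_form"
      using C continuous_trilinear_extremal_form unfolding BH_bound_def by simp
    finally have *: "4 * 2 powr ((\<theta> + 3) / 4) \<le> C * form_norm extremal_form" .
    have "0 \<le> C"
    proof (rule ccontr)
      assume "\<not> 0 \<le> C"
      then have "C * form_norm extremal_form \<le> 0"
        using form_norm_nonneg[OF continuous_trilinear_extremal_form] by (intro mult_nonpos_nonneg) auto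
      moreover have "0 < 4 * 2 powr ((\<theta> + 3) / 4)" by simp
      ultimately show False using * by linarith
    qed
    then have "C * form_norm extremal_form \<le> C * 4"
      using form_norm_extremal_form by (intro mult_left_mono)
    with * show ?thesis by linarith
  qed
  with BH_bound_interpolated[OF \<tau> \<theta> q pos] show ?thesis
    unfolding optimal_BH_constant_def q1_def[symmetric] q2_def[symmetric] q3_def[symmetric] by blast
qed

end
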